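(* Let $\Delta$ be a $d$-dimensional linear tree with $m$ facets and vertices $x_1,\dots,x_n$, and let $I\subset R=K[x_1,\dots,x_n]$ be its facet ideal. Then $$b_i(R/I)=\begin{cases} m, & \text{if } i=1,\\ \sum_{G}\binom{m(G)}{i}, & \text{if } i\ge 2,\end{cases}$$ where the sum is taken over all $(d-1)$-dimensional faces $G$ of $\Delta$, and $m(G)=|\{F\in\mathcal F(\Delta) : G\subset F\}|$.
   Context: A simplicial complex $\Delta$ on a finite vertex set is a collection of subsets containing all singletons and closed under taking subsets; $\dim F=|F|-1$ for a face $F$ (so $\dim\emptyset=-1$). Facets are the maximal faces, $\mathcal F(\Delta)$ is the set of facets; $\dim\Delta$ is the maximal dimension of a facet. A subcomplex of $\Delta$ is a simplicial complex $\Gamma$ with $\mathcal F(\Gamma)\subseteq\mathcal F(\Delta)$. $\Delta$ is connected if for any two facets $F,G$ there are facets $F=F_0,\dots,F_q=G$ with $F_i\cap F_{i+1}\ne\emptyset$ for all $i$. A facet $F$ is a leaf if it is the only facet of $\Delta$, or there is a facet $G\ne F$ with $F\cap H\subseteq F\cap G$ for every facet $H\ne F$. A tree is a connected simplicial complex every nonempty subcomplex of which has a leaf. $K$ is a field, the vertices of $\Delta$ are identified with the variables of $R$, and the facet ideal is generated by the monomials $x_{i_1}\cdots x_{i_s}$ with $\{x_{i_1},\dots,x_{i_s}\}$ a facet. A linear tree is a tree whose facet ideal has a linear resolution. $b_i(M)=\dim_K\operatorname{Tor}_i^R(K,M)$ are the (total) Betti numbers. *)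

theory Defs
  imports
    "HOL-Library.Poly_Mapping"
    "Jordan_Normal_Form.Matrix_Kernel"
    "Jordan_Normal_Form.DL_Rank"
begin

section \<open>Simplicial complexes and trees\<close>

definition simplicial_complex :: "'v set \<Rightarrow> 'v set set \<Rightarrow> bool" where
  "simplicial_complex V \<Delta> \<longleftrightarrow>
     finite V \<and> \<Delta> \<subseteq> Pow V \<and> (\<forall>v\<in>V. {v} \<in> \<Delta>) \<and> (\<forall>F\<in>\<Delta>. \<forall>G. G \<subseteq> F \<longrightarrow> G \<in> \<Delta>)"

definition facets :: "'v set set \<Rightarrow> 'v set set" where
  "facets \<Delta> = {F \<in> \<Delta>. \<forall>G\<in>\<Delta>. F \<subseteq> G \<longrightarrow> F = G}"

definition face_dim :: "'v set \<Rightarrow> int" where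
  "face_dim F = int (card F) - 1"

definition complex_dim :: "'v set set \<Rightarrow> int" where
  "complex_dim \<Delta> = Max (face_dim ` facets \<Delta>)"

text \<open>A subcomplex may live on a smaller vertex set \<open>W\<close>.\<close>

definition subcomplex :: "'v set set \<Rightarrow> 'v set set \<Rightarrow> bool" where
  "subcomplex \<Gamma> \<Delta> \<longleftrightarrow> (\<exists>W. simplicial_complex W \<Gamma>) \<and> facets \<Gamma> \<subseteq> facets \<Delta>"

definition connected_complex :: "'v set set \<Rightarrow> bool" where
  "connected_complex \<Delta> \<longleftrightarrow>
     (\<forall>F\<in>facets \<Delta>. \<forall>G\<in>facets \<Delta>. \<exists>(q::nat) f. f 0 = F \<and> f q = G \<and>
        (\<forall>i\<le>q. f i \<in> facets \<Delta>) \<and> (\<forall>i<q. f i \<inter> f (Suc i) \<noteq> {}))"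

definition leaf :: "'v set set \<Rightarrow> 'v set \<Rightarrow> bool" where
  "leaf \<Delta> F \<longleftrightarrow> F \<in> facets \<Delta> \<and>
     (facets \<Delta> = {F} \<or>
      (\<exists>G\<in>facets \<Delta>. G \<noteq> F \<and> (\<forall>H\<in>facets \<Delta>. H \<noteq> F \<longrightarrow> F \<inter> H \<subseteq> F \<inter> G)))"

definition tree :: "'v set \<Rightarrow> 'v set set \<Rightarrow> bool" where
  "tree V \<Delta> \<longleftrightarrow> simplicial_complex V \<Delta> \<and> connected_complex \<Delta> \<and>
     (\<forall>\<Gamma>. subcomplex \<Gamma> \<Delta> \<and> \<Gamma> \<noteq> {} \<longrightarrow> (\<exists>F. leaf \<Gamma> F))"


section \<open>The polynomial ring and facet ideals\<close>

text \<open>\<open>('v, 'k) mpoly\<close> is the polynomial ring \<open>R\<close> over the field \<open>'k\<close> whose variables are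
  the elements of \<open>'v\<close>: finitely supported functions from exponent vectors to
  coefficients.\<close>

type_synonym ('v, 'k) mpoly = "('v \<Rightarrow>\<^sub>0 nat) \<Rightarrow>\<^sub>0 'k"

definition Var :: "'v \<Rightarrow> ('v, 'k::field) mpoly" where
  "Var v = Poly_Mapping.single (Poly_Mapping.single v 1) 1"

definition homogeneous :: "nat \<Rightarrow> ('v, 'k::field) mpoly \<Rightarrow> bool" where
  "homogeneous k p \<longleftrightarrow>
     (\<forall>t \<in> Poly_Mapping.keys p. (\<Sum>v \<in> Poly_Mapping.keys t. Poly_Mapping.lookup t v) = k)"

definition ideal_gen :: "('v, 'k::field) mpoly set \<Rightarrow> ('v, 'k) mpoly set" where
  "ideal_gen S = {\<Sum>s\<in>T. r s * s | T r. finite T \<and> T \<subseteq> S}"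

definition facet_ideal :: "'v set set \<Rightarrow> ('v, 'k::field) mpoly set" where
  "facet_ideal \<Delta> = ideal_gen ((\<lambda>F. \<Prod>v\<in>F. Var v) ` facets \<Delta>)"


section \<open>Free resolutions, linear resolutions and Betti numbers\<close>

definition mat_range :: "'a::comm_ring_1 mat \<Rightarrow> 'a vec set" where
  "mat_range A = (\<lambda>v. A *\<^sub>v v) ` carrier_vec (dim_col A)"

text \<open>\<open>free_resolution d e J I\<close>: for ideals \<open>I \<subseteq> J\<close> of \<open>R\<close>, the matrices \<open>d\<close> and the row \<open>e\<close>
  form a resolution of the module \<open>J/I\<close> by free modules of finite rank
    \<open>\<dots> \<rightarrow> F\<^sub>2 \<rightarrow> F\<^sub>1 \<rightarrow> F\<^sub>0 \<rightarrow> J/I \<rightarrow> 0\<close>.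
  Here \<open>F\<^sub>i\<close> is \<open>R\<close> to the power \<open>dim_col (d i)\<close>, the map \<open>F\<^sub>i \<rightarrow> F\<^sub>i\<^sub>-\<^sub>1\<close> is \<open>d i\<close> for \<open>i > 0\<close>,
  and \<open>F\<^sub>0 \<rightarrow> J/I\<close> sends \<open>v\<close> to the class of \<open>e \<bullet> v\<close>. The matrix \<open>d 0\<close> has no rows: it is
  the zero map \<open>F\<^sub>0 \<rightarrow> 0\<close> ending the complex from which the augmentation is removed.
  The last two conditions are surjectivity of \<open>F\<^sub>0 \<rightarrow> J/I\<close> and exactness at \<open>F\<^sub>0\<close>.
  The cases used are \<open>R/I\<close>, which is \<open>J = UNIV\<close>, and \<open>I\<close> itself, which is \<open>I/{0}\<close>.\<close>

definition free_resolution ::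
  "(nat \<Rightarrow> ('v, 'k::field) mpoly mat) \<Rightarrow> ('v, 'k) mpoly vec
     \<Rightarrow> ('v, 'k) mpoly set \<Rightarrow> ('v, 'k) mpoly set \<Rightarrow> bool" where
  "free_resolution d e J I \<longleftrightarrow>
     dim_row (d 0) = 0 \<and>
     (\<forall>i. dim_row (d (Suc i)) = dim_col (d i)) \<and>
     (\<forall>i. mat_kernel (d (Suc i)) = mat_range (d (Suc (Suc i)))) \<and>
     e \<in> carrier_vec (dim_col (d 0)) \<and>
     {e \<bullet> v + a | v a. v \<in> carrier_vec (dim_col (d 0)) \<and> a \<in> I} = J \<and>
     {v \<in> carrier_vec (dim_col (d 0)). e \<bullet> v \<in> I} = mat_range (d 1)"

text \<open>The ideal \<open>I\<close> has a linear resolution if, for some \<open>D\<close>, it has a graded free resolution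
  with \<open>F\<^sub>i = R(-D-i)\<^bsup>b\<^sub>i\<^esup>\<close>. Since a map \<open>R(-a) \<rightarrow> R(-b)\<close> of degree 0 is multiplication by a
  form of degree \<open>a - b\<close>, this says that the generators in \<open>e\<close> are forms of degree \<open>D\<close> and
  that all entries of the matrices are linear forms (zero being a form of every degree).
  Such a resolution is minimal automatically.\<close>

definition has_linear_resolution :: "('v, 'k::field) mpoly set \<Rightarrow> bool" where
  "has_linear_resolution I \<longleftrightarrow>
     (\<exists>D d e. free_resolution d e I {0} \<and>
        (\<forall>j < dim_vec e. homogeneous D (e $ j)) \<and>
        (\<forall>i \<ge> 1. \<forall>r < dim_row (d i). \<forall>c < dim_col (d i). homogeneous 1 (d i $$ (r, c))))"

text \<open>\<open>K \<otimes>\<^sub>R R\<^sup>b = K\<^sup>b\<close>, where \<open>K\<close> is the quotient of \<open>R\<close> by the ideal of all variables; so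
  tensoring a matrix with \<open>K\<close> replaces every entry by its constant coefficient.\<close>

definition tensor_residue_field :: "('v, 'k::field) mpoly mat \<Rightarrow> 'k mat" where
  "tensor_residue_field A = map_mat (\<lambda>p. Poly_Mapping.lookup p 0) A"

text \<open>The dimension of the \<open>i\<close>-th homology \<open>ker (K \<otimes> d i) / im (K \<otimes> d (i + 1))\<close> of \<open>K \<otimes> F\<close>;
  the image lies in the kernel, so the subtraction does not truncate.\<close>

definition tor_dim :: "(nat \<Rightarrow> ('v, 'k::field) mpoly mat) \<Rightarrow> nat \<Rightarrow> nat" where
  "tor_dim d i =
     kernel_dim (tensor_residue_field (d i))
     - vec_space.rank (dim_row (d (Suc i))) (tensor_residue_field (d (Suc i)))"

text \<open>\<open>betti J I i\<close> is the \<open>K\<close>-dimension of \<open>Tor\<^sub>i(K, J/I)\<close>, computed as usual from a choice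
  of free resolution of \<open>J/I\<close>. Finite ranks suffice as \<open>R\<close> is Noetherian (\<open>'v\<close> is finite).\<close>

definition betti ::
  "('v::finite, 'k::field) mpoly set \<Rightarrow> ('v, 'k) mpoly set \<Rightarrow> nat \<Rightarrow> nat" where
  "betti J I i = tor_dim (fst (SOME (d, e). free_resolution d e J I)) i"

text \<open>The variables of \<open>R\<close> are exactly the vertices of \<open>\<Delta>\<close>, so the vertex set is \<open>UNIV\<close>. The
  first argument only names the field \<open>K\<close>.\<close>

definition linear_tree :: "'k::field itself \<Rightarrow> 'v::finite set set \<Rightarrow> bool" where
  "linear_tree K \<Delta> \<longleftrightarrow>
     tree UNIV \<Delta> \<and> has_linear_resolution (facet_ideal \<Delta> :: ('v, 'k) mpoly set)"

end

theory Submission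
  imports Defs
begin

text \<open>
  The facet ideal of a linear tree has linear quotients, and the Betti numbers are read off from an
  iterated mapping cone.

  A linear resolution first of all forces every facet to have the same number \<open>D = d + 1\<close> of vertices
  (\<open>linear_resolution_generator_degree\<close>). Its first syzygies are linear, and this connects the facets:
  any two of them, \<open>F\<close> and \<open>H\<close>, are joined by a walk of facets inside \<open>F \<union> H\<close> in which consecutive facets
  share a ridge, a face with \<open>D - 1\<close> vertices (\<open>linear_resolution_linked\<close>).

  Now let \<open>F\<close> be a leaf. All its intersections with other facets lie in a single set \<open>B = F \<inter> G\<close>, and the
  first step of a walk from \<open>F\<close> shows that \<open>B\<close> is a ridge and that every other facet \<open>H\<close> contains a
  vertex \<open>v\<close> outside \<open>F\<close> for which \<open>B \<union> {v}\<close> is a facet (\<open>linked_to_leaf_step\<close>). Hence the ideal \<open>J\<close> of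
  the remaining facets satisfies \<open>J : x\<^sup>F = (x\<^sub>v | B \<union> {v} is a facet other than F)\<close>, an ideal generated by as
  many variables as there are other facets containing \<open>B\<close>. Walks through \<open>F\<close> enter and leave it across
  \<open>B\<close> and can be cut short, so the remaining facets are again connected in this way
  (\<open>linked_remove_leaf\<close>), and every nonempty set of facets of a tree has a leaf. Thus one may induct.

  If \<open>J\<close> has a minimal resolution of ranks \<open>b i\<close>, the cone over \<open>R/(J : x\<^sup>F) \<rightarrow> R/J\<close>, with the Koszul complex on
  \<open>q\<close> variables as the resolution of the source, resolves \<open>R/(J + (x\<^sup>F))\<close> with ranks
  \<open>b i + (q choose (i - 1))\<close>. It is minimal because multiplication by \<open>x\<^sup>F\<close> factors through
  multiplication by \<open>x\<^sup>B\<close> (\<open>has_minimal_resolution_add_generator\<close>). The closed formula changes by the same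
  amount, as only the degree of the ridge \<open>B\<close> matters (\<open>linear_tree_betti_insert\<close>).

  Betti numbers are defined from an unspecified free resolution. That every resolution gives the
  ranks of a minimal one follows from the comparison theorem (\<open>chain_map_lift\<close>, \<open>null_homotopy\<close>,
  \<open>tor_dim_eq_minimal_rank\<close>).
\<close>

section \<open>Kernels and column spaces over a field\<close>

lemma zero_mat_mult_vec:
  "v \<in> carrier_vec nc \<Longrightarrow> 0\<^sub>m nr nc *\<^sub>v v = 0\<^sub>v nr"
  by (rule eq_vecI) auto

lemma (in vec_space) span_cols_eq_mat_range:
  fixes A :: "'a mat"
  assumes A: "A \<in> carrier_mat n nc"
  shows "span (set (cols A)) = mat_range A"
proof -
  have cs: "set (cols A) \<subseteq> carrier_vec n" and len: "length (cols A) = nc"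
    using A cols_dim[of A] by auto
  have mc: "mat_of_cols n (cols A) = A"
    using A by (metis carrier_matD(1) mat_of_cols_cols)
  have "span_list (cols A) = mat_range A"
  proof
    show "span_list (cols A) \<subseteq> mat_range A"
    proof
      fix x assume "x \<in> span_list (cols A)"
      then obtain c where "x = lincomb_list c (cols A)" unfolding span_list_def by auto
      also have "\<dots> = mat_of_cols n (cols A) *\<^sub>v vec (length (cols A)) c"
        by (rule lincomb_list_as_mat_mult) (use cs in auto)
      finally have "x = A *\<^sub>v vec nc c"
        using A by (simp add: mc)
      then show "x \<in> mat_range A" using A unfolding mat_range_def by auto
    qed
    show "mat_range A \<subseteq> span_list (cols A)"
    proof
      fix x assume "x \<in> mat_range A"
      then obtain v where v: "v \<in> carrier_vec nc" "x = A *\<^sub>v v"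
        using A unfolding mat_range_def by auto
      have "lincomb_list (($) v) (cols A) = mat_of_cols n (cols A) *\<^sub>v vec (length (cols A)) (($) v)"
        by (rule lincomb_list_as_mat_mult) (use cs in auto)
      also have "vec (length (cols A)) (($) v) = v" using v len by auto
      finally have "x = lincomb_list (($) v) (cols A)" using v mc by simp
      then show "x \<in> span_list (cols A)" by (auto simp: span_list_def)
    qed
  qed
  then show ?thesis using span_list_as_span[OF cs] by simp
qed

text \<open>The linear algebra behind the uniqueness of Tor: a complex that is homotopy equivalent to
  one with zero differentials and \<open>b\<close>-dimensional middle term has \<open>b\<close>-dimensional homology. Indeed
  \<open>\<phi>\<close> maps the kernel of \<open>A\<close> onto \<open>K\<^sup>b\<close>, since \<open>c\<close> is the image of \<open>\<psi> c\<close>, and the homotopy shows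
  that the only vectors killed are those in the column space of \<open>B\<close>; rank-nullity for this
  restriction of \<open>\<phi>\<close> is the claim.\<close>

lemma kernel_dim_retract:
  fixes A B \<phi> \<psi> h h' :: "'a::field mat"
  assumes A: "A \<in> carrier_mat r n" and B: "B \<in> carrier_mat n k"
    and \<phi>: "\<phi> \<in> carrier_mat b n" and \<psi>: "\<psi> \<in> carrier_mat n b"
    and h: "h \<in> carrier_mat k n" and h': "h' \<in> carrier_mat n r"
    and AB: "A * B = 0\<^sub>m r k" and \<phi>B: "\<phi> * B = 0\<^sub>m b k" and A\<psi>: "A * \<psi> = 0\<^sub>m r b"
    and \<phi>\<psi>: "\<phi> * \<psi> = 1\<^sub>m b" and hom: "\<psi> * \<phi> - 1\<^sub>m n = B * h + h' * A"
  shows "kernel_dim A = vec_space.rank n B + b"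
proof -
  interpret N: vec_space "TYPE('a)" n .
  interpret W: vec_space "TYPE('a)" b .
  interpret K: kernel r n A by unfold_locales (rule A)
  define E where "E = \<psi> * \<phi> - B * h"
  have E: "E \<in> carrier_mat n n" unfolding E_def using B h \<phi> \<psi> by auto
  have rangeB: "mat_range B \<subseteq> mat_kernel A"
  proof
    fix x assume "x \<in> mat_range B"
    then obtain v where v: "v \<in> carrier_vec k" "x = B *\<^sub>v v" unfolding mat_range_def using B by auto
    have "A *\<^sub>v x = (A * B) *\<^sub>v v" using v A B by (simp add: assoc_mult_mat_vec[of _ r n _ k])
    also have "\<dots> = 0\<^sub>v r" using AB v by (simp add: zero_mat_mult_vec)
    finally show "x \<in> mat_kernel A" using A B v by (auto simp: mat_kernel[OF A])
  qed
  have \<psi>ker: "\<psi> *\<^sub>v c \<in> mat_kernel A" if "c \<in> carrier_vec b" for c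
  proof -
    have "A *\<^sub>v (\<psi> *\<^sub>v c) = (A * \<psi>) *\<^sub>v c"
      using that A \<psi> by (simp add: assoc_mult_mat_vec[of _ r n _ b])
    then show ?thesis using A\<psi> that \<psi> by (auto simp: zero_mat_mult_vec mat_kernel[OF A])
  qed
  have retract: "\<psi> *\<^sub>v (\<phi> *\<^sub>v x) = x + B *\<^sub>v (h *\<^sub>v x)" if x: "x \<in> mat_kernel A" for x
  proof -
    have xc: "x \<in> carrier_vec n" and Ax: "A *\<^sub>v x = 0\<^sub>v r" using x by (auto simp: mat_kernel[OF A])
    have "(\<psi> * \<phi> - 1\<^sub>m n) *\<^sub>v x = \<psi> *\<^sub>v (\<phi> *\<^sub>v x) - x"
      using xc \<phi> \<psi> by (simp add: minus_mult_distrib_mat_vec[of _ n n] assoc_mult_mat_vec[of _ n b _ n])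
    moreover have "(B * h + h' * A) *\<^sub>v x = B *\<^sub>v (h *\<^sub>v x) + h' *\<^sub>v (A *\<^sub>v x)"
      using xc B h h' A by (simp add: add_mult_distrib_mat_vec[of _ n n] 
          assoc_mult_mat_vec[of _ n k _ n] assoc_mult_mat_vec[of _ n r _ n])
    moreover have "h' *\<^sub>v (A *\<^sub>v x) = 0\<^sub>v n" unfolding Ax using h' by auto
    moreover have "B *\<^sub>v (h *\<^sub>v x) \<in> carrier_vec n" using B h xc by auto
    ultimately have eq: "\<psi> *\<^sub>v (\<phi> *\<^sub>v x) - x = B *\<^sub>v (h *\<^sub>v x)" using hom by simp
    have "\<psi> *\<^sub>v (\<phi> *\<^sub>v x) = x + (\<psi> *\<^sub>v (\<phi> *\<^sub>v x) - x)"
      by (rule eq_vecI) (use xc \<phi> \<psi> in auto)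
    then show ?thesis unfolding eq .
  qed
  \<comment> \<open>On the kernel of \<open>A\<close> the map \<open>E\<close> is the identity by the homotopy, and \<open>E\<close> takes its values
    there; so the kernel is a column space, which gives the finite dimension that rank-nullity needs.\<close>
  have kerE: "mat_kernel A = mat_range E"
  proof
    show "mat_kernel A \<subseteq> mat_range E"
    proof
      fix x assume x: "x \<in> mat_kernel A"
      then have xc: "x \<in> carrier_vec n" by (auto simp: mat_kernel[OF A])
      have "E *\<^sub>v x = \<psi> *\<^sub>v (\<phi> *\<^sub>v x) - B *\<^sub>v (h *\<^sub>v x)"
        unfolding E_def using xc \<phi> \<psi> B h
        by (simp add: minus_mult_distrib_mat_vec[of _ n n] assoc_mult_mat_vec[of _ n b _ n]
            assoc_mult_mat_vec[of _ n k _ n])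
      also have "\<dots> = x" unfolding retract[OF x] by (rule eq_vecI) (use xc B in auto)
      finally show "x \<in> mat_range E" unfolding mat_range_def using xc E by (metis carrier_matD(2) imageI)
    qed
    have "A * E = (A * \<psi>) * \<phi> - (A * B) * h"
      unfolding E_def using A \<psi> \<phi> B h
      by (simp add: mult_minus_distrib_mat[of _ r n _ n] assoc_mult_mat[of _ r n _ b] assoc_mult_mat[of _ r n _ k])
    also have "\<dots> = 0\<^sub>m r n" unfolding A\<psi> AB using \<phi> h by (auto intro!: eq_matI)
    finally have AE: "A * E = 0\<^sub>m r n" .
    show "mat_range E \<subseteq> mat_kernel A"
    proof
      fix x assume "x \<in> mat_range E"
      then obtain v where v: "v \<in> carrier_vec n" "x = E *\<^sub>v v" unfolding mat_range_def using E by auto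
      have "A *\<^sub>v x = (A * E) *\<^sub>v v" using v A E by (simp add: assoc_mult_mat_vec[of _ r n _ n])
      then show "x \<in> mat_kernel A" using AE E v by (auto simp: zero_mat_mult_vec mat_kernel[OF A])
    qed
  qed
  have fd: "K.Ker.fin_dim"
    using N.fin_dim_span_cols[OF E] unfolding N.span_cols_eq_mat_range[OF E] kerE .
  interpret L: linear_map class_ring K.VK W.V "\<lambda>v. \<phi> *\<^sub>v v"
  proof unfold_locales
    have sub: "\<And>x. x \<in> mat_kernel A \<Longrightarrow> x \<in> carrier_vec n" by (auto simp: mat_kernel[OF A])
    show "(*\<^sub>v) \<phi> \<in> LinearCombinations.module_hom class_ring K.VK W.V"
      unfolding LinearCombinations.module_hom_def
      using \<phi> sub mult_add_distrib_mat_vec[OF \<phi>] mult_mat_vec[OF \<phi>] 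
      by (auto simp: class_ring_simps)
  qed
  have im: "L.imT = carrier_vec b"
  proof -
    have "c \<in> (*\<^sub>v) \<phi> ` mat_kernel A" if c: "c \<in> carrier_vec b" for c
    proof
      show "c = \<phi> *\<^sub>v (\<psi> *\<^sub>v c)"
        using c \<phi>\<psi> \<phi> \<psi> by (simp flip: assoc_mult_mat_vec[of _ b n _ b])
    qed (rule \<psi>ker[OF c])
    then show ?thesis unfolding L.im_def using \<phi> by (auto simp: mat_kernel[OF A])
  qed
  have ker: "L.kerT = mat_range B"
  proof -
    have "x \<in> mat_range B" if x: "x \<in> mat_kernel A" and \<phi>x: "\<phi> *\<^sub>v x = 0\<^sub>v b" for x
    proof -
      have xc: "x \<in> carrier_vec n" using x by (auto simp: mat_kernel[OF A])
      have z: "\<psi> *\<^sub>v (\<phi> *\<^sub>v x) = 0\<^sub>v n" unfolding \<phi>x using \<psi> by auto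
      have "x = x + B *\<^sub>v (h *\<^sub>v x) + B *\<^sub>v (- (h *\<^sub>v x))"
        by (rule eq_vecI) (use xc B h in auto)
      also have "\<dots> = B *\<^sub>v (- (h *\<^sub>v x))" 
        using B h xc unfolding retract[OF x, symmetric] z by auto
      finally show ?thesis unfolding mat_range_def using B h xc by auto
    qed
    moreover have "\<phi> *\<^sub>v x = 0\<^sub>v b" if x: "x \<in> mat_range B" for x
    proof -
      obtain v where v: "v \<in> carrier_vec k" "x = B *\<^sub>v v" using x unfolding mat_range_def using B by auto
      have "\<phi> *\<^sub>v x = (\<phi> * B) *\<^sub>v v" using v \<phi> B by (simp add: assoc_mult_mat_vec[of _ b n _ k])
      then show ?thesis using \<phi>B v by (simp add: zero_mat_mult_vec)
    qed
    ultimately show ?thesis unfolding L.ker_def using rangeB by auto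
  qed
  have "vectorspace.dim class_ring (W.V\<lparr>carrier := L.imT\<rparr>)
      + vectorspace.dim class_ring (K.VK\<lparr>carrier := L.kerT\<rparr>) = K.Ker.dim"
    by (rule L.rank_nullity[OF fd])
  moreover have "W.V\<lparr>carrier := L.imT\<rparr> = W.V" unfolding im by (simp add: module_vec_def)
  moreover have "vectorspace.dim class_ring (K.VK\<lparr>carrier := L.kerT\<rparr>) = N.rank B"
    unfolding ker N.rank_def N.span_cols_eq_mat_range[OF B] by simp
  ultimately show ?thesis unfolding K.kernel_dim by (simp add: W.dim_is_n)
qed

section \<open>Maps between free resolutions\<close>

definition is_ideal :: "'a::comm_ring_1 set \<Rightarrow> bool" where
  "is_ideal I \<longleftrightarrow> 0 \<in> I \<and> (\<forall>a\<in>I. \<forall>b\<in>I. a + b \<in> I) \<and> (\<forall>a\<in>I. \<forall>r. r * a \<in> I)"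

lemma is_ideal_diff: "is_ideal I \<Longrightarrow> a \<in> I \<Longrightarrow> b \<in> I \<Longrightarrow> a - b \<in> I"
  unfolding is_ideal_def by (metis diff_conv_add_uminus mult_minus1)

lemma is_ideal_uminus: "is_ideal I \<Longrightarrow> a \<in> I \<Longrightarrow> - a \<in> I"
  using is_ideal_diff[of I 0 a] by (simp add: is_ideal_def)

lemma is_ideal_sum: "is_ideal I \<Longrightarrow> (\<And>x. x \<in> A \<Longrightarrow> f x \<in> I) \<Longrightarrow> sum f A \<in> I"
  by (induction A rule: infinite_finite_induct) (auto simp: is_ideal_def)

lemma mat_rangeI: "A \<in> carrier_mat n k \<Longrightarrow> v \<in> carrier_vec k \<Longrightarrow> A *\<^sub>v v \<in> mat_range A"
  unfolding mat_range_def by auto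

lemma mat_rangeE:
  assumes "x \<in> mat_range A" "A \<in> carrier_mat n k"
  obtains v where "v \<in> carrier_vec k" "x = A *\<^sub>v v"
  using assms unfolding mat_range_def by auto

lemma eq_mat_by_mult_vec:
  fixes A B :: "'a::comm_ring_1 mat"
  assumes A: "A \<in> carrier_mat n k" and B: "B \<in> carrier_mat n k"
    and eq: "\<And>v. v \<in> carrier_vec k \<Longrightarrow> A *\<^sub>v v = B *\<^sub>v v"
  shows "A = B"
proof (rule eq_matI)
  fix i j assume i: "i < dim_row B" and j: "j < dim_col B"
  have "(A *\<^sub>v unit_vec k j) $ i = (B *\<^sub>v unit_vec k j) $ i" using eq by simp
  then show "A $$ (i, j) = B $$ (i, j)" using A B i j by (simp add: scalar_prod_right_unit)
qed (use A B in auto)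

text \<open>Free modules are projective: a matrix whose columns lie in the column module of \<open>B\<close>
  factors through \<open>B\<close>.\<close>

lemma mat_factor_through:
  fixes A B :: "'a::comm_ring_1 mat"
  assumes A: "A \<in> carrier_mat n k" and B: "B \<in> carrier_mat n l"
    and range: "\<And>v. v \<in> carrier_vec k \<Longrightarrow> A *\<^sub>v v \<in> mat_range B"
  obtains Y where "Y \<in> carrier_mat l k" "A = B * Y"
proof -
  have "\<exists>y. y \<in> carrier_vec l \<and> A *\<^sub>v unit_vec k j = B *\<^sub>v y" for j
    using range[of "unit_vec k j"] B by (auto elim: mat_rangeE)
  then obtain y where y: "\<And>j. y j \<in> carrier_vec l" "\<And>j. A *\<^sub>v unit_vec k j = B *\<^sub>v y j" by metis
  define Y where "Y = mat_of_cols l (map y [0..<k])"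
  have Y: "Y \<in> carrier_mat l k" unfolding Y_def by auto
  have "A = B * Y"
  proof (rule eq_matI)
    fix i j assume "i < dim_row (B * Y)" and "j < dim_col (B * Y)"
    then have i: "i < n" and j: "j < k" using B Y by auto
    have "col Y j = y j" unfolding Y_def using j y(1) by (subst col_mat_of_cols) auto
    moreover have "(A *\<^sub>v unit_vec k j) $ i = (B *\<^sub>v y j) $ i" using y(2) by simp
    ultimately show "A $$ (i, j) = (B * Y) $$ (i, j)"
      using A B Y i j by (simp add: scalar_prod_right_unit)
  qed (use A B Y in auto)
  then show ?thesis using that Y by blast
qed

context
  fixes d :: "nat \<Rightarrow> ('v, 'k::field) mpoly mat" and e J I
  assumes res: "free_resolution d e J I"
begin

lemma free_resolution_carrier:
  "d 0 \<in> carrier_mat 0 (dim_col (d 0))"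
  "d (Suc i) \<in> carrier_mat (dim_col (d i)) (dim_col (d (Suc i)))"
  "e \<in> carrier_vec (dim_col (d 0))"
proof -
  have "dim_row (d 0) = 0" "dim_row (d (Suc i)) = dim_col (d i)"
    using res unfolding free_resolution_def by blast+
  then show "d 0 \<in> carrier_mat 0 (dim_col (d 0))"
    "d (Suc i) \<in> carrier_mat (dim_col (d i)) (dim_col (d (Suc i)))" by auto
  show "e \<in> carrier_vec (dim_col (d 0))" using res unfolding free_resolution_def by blast
qed

lemma free_resolution_exact:
  assumes "v \<in> carrier_vec (dim_col (d (Suc i)))" "d (Suc i) *\<^sub>v v = 0\<^sub>v (dim_col (d i))"
  shows "v \<in> mat_range (d (Suc (Suc i)))"
proof -
  have "mat_kernel (d (Suc i)) = mat_range (d (Suc (Suc i)))"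
    using res unfolding free_resolution_def by blast
  then show ?thesis using mat_kernelI[OF free_resolution_carrier(2) assms] by simp
qed

lemma free_resolution_comp_zero:
  "d (Suc i) * d (Suc (Suc i)) = 0\<^sub>m (dim_col (d i)) (dim_col (d (Suc (Suc i))))"
proof -
  note c = free_resolution_carrier(2)[of i] free_resolution_carrier(2)[of "Suc i"]
  have "(d (Suc i) * d (Suc (Suc i))) *\<^sub>v v = 0\<^sub>v (dim_col (d i))"
    if v: "v \<in> carrier_vec (dim_col (d (Suc (Suc i))))" for v
  proof -
    have "mat_kernel (d (Suc i)) = mat_range (d (Suc (Suc i)))"
      using res unfolding free_resolution_def by blast
    then have "d (Suc (Suc i)) *\<^sub>v v \<in> mat_kernel (d (Suc i))"
      using mat_rangeI[OF c(2) v] by simp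
    then show ?thesis unfolding assoc_mult_mat_vec[OF c v] by (rule mat_kernelD(2)[OF c(1)])
  qed
  then show ?thesis
    by (intro eq_mat_by_mult_vec[OF mult_carrier_mat[OF c] zero_carrier_mat]) (simp only: zero_mat_mult_vec)
qed

lemma free_resolution_augment:
  assumes "v \<in> carrier_vec (dim_col (d 0))" "e \<bullet> v \<in> I"
  shows "v \<in> mat_range (d (Suc 0))"
proof -
  have "{v \<in> carrier_vec (dim_col (d 0)). e \<bullet> v \<in> I} = mat_range (d (Suc 0))"
    using res unfolding free_resolution_def One_nat_def by blast
  then show ?thesis using assms by blast
qed

lemma free_resolution_augment_comp:
  assumes "v \<in> carrier_vec (dim_col (d (Suc 0)))"
  shows "e \<bullet> (d (Suc 0) *\<^sub>v v) \<in> I"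
proof -
  have "{v \<in> carrier_vec (dim_col (d 0)). e \<bullet> v \<in> I} = mat_range (d (Suc 0))"
    using res unfolding free_resolution_def One_nat_def by blast
  then show ?thesis using mat_rangeI[OF free_resolution_carrier(2) assms] by blast
qed

lemma free_resolution_generates:
  assumes "a \<in> J"
  obtains v b where "v \<in> carrier_vec (dim_col (d 0))" "b \<in> I" "a = e \<bullet> v + b"
proof -
  have "{e \<bullet> v + a | v a. v \<in> carrier_vec (dim_col (d 0)) \<and> a \<in> I} = J"
    using res unfolding free_resolution_def by blast
  then show ?thesis using assms that by blast
qed

end

lemma scalar_prod_mult_mat_vec:
  fixes e :: "'a::comm_ring_1 vec"
  assumes "e \<in> carrier_vec n" "A \<in> carrier_mat n k" "v \<in> carrier_vec k"
  shows "e \<bullet> (A *\<^sub>v v) = (\<Sum>j<k. v $ j * (e \<bullet> col A j))"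
proof -
  have "e \<bullet> (A *\<^sub>v v) = (\<Sum>i\<in>{0..<n}. \<Sum>j\<in>{0..<k}. e $ i * (A $$ (i, j) * v $ j))"
    using assms by (auto simp: scalar_prod_def sum_distrib_left intro!: sum.cong)
  also have "\<dots> = (\<Sum>j\<in>{0..<k}. \<Sum>i\<in>{0..<n}. e $ i * (A $$ (i, j) * v $ j))"
    by (rule sum.swap)
  also have "\<dots> = (\<Sum>j<k. v $ j * (e \<bullet> col A j))"
    using assms by (auto simp: scalar_prod_def sum_distrib_left atLeast0LessThan algebra_simps intro!: sum.cong)
  finally show ?thesis .
qed

text \<open>The comparison theorem: if \<open>g I' \<subseteq> I\<close> then multiplication by \<open>g\<close> is a map \<open>R/I' \<rightarrow> R/I\<close>, and it
  lifts to the resolutions one degree at a time, because the composite that has to be factored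
  lands in a kernel and hence, by exactness, in a column module.\<close>

lemma chain_map_lift:
  assumes P: "free_resolution d e UNIV I" and Q: "free_resolution d' e' UNIV I'"
    and I: "is_ideal I" and g: "\<And>a. a \<in> I' \<Longrightarrow> g * a \<in> I"
  obtains \<phi> where "\<And>i. \<phi> i \<in> carrier_mat (dim_col (d i)) (dim_col (d' i))"
    and "\<And>i. \<phi> i * d' (Suc i) = d (Suc i) * \<phi> (Suc i)"
    and "\<And>v. v \<in> carrier_vec (dim_col (d' 0)) \<Longrightarrow> e \<bullet> (\<phi> 0 *\<^sub>v v) - g * (e' \<bullet> v) \<in> I"
proof -
  define p where "p i = dim_col (d i)" for i
  define q where "q i = dim_col (d' i)" for i
  note Pc = free_resolution_carrier[OF P, folded p_def]
  note Qc = free_resolution_carrier[OF Q, folded q_def]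
  define aug where "aug X \<longleftrightarrow> (\<forall>v\<in>carrier_vec (q 0). e \<bullet> (X *\<^sub>v v) - g * (e' \<bullet> v) \<in> I)" for X
  \<comment> \<open>The invariant of the construction: the square that starts at \<open>X\<close> in degree \<open>n\<close> can be completed.\<close>
  define ok where "ok n X \<longleftrightarrow> X \<in> carrier_mat (p n) (q n) \<and>
      (\<forall>v\<in>carrier_vec (q (Suc n)). X * d' (Suc n) *\<^sub>v v \<in> mat_range (d (Suc n))) \<and> (n = 0 \<longrightarrow> aug X)" for n X
  have base: "\<exists>X. ok 0 X"
  proof -
    have "\<exists>v. v \<in> carrier_vec (p 0) \<and> e \<bullet> v - g * e' $ j \<in> I" for j
    proof -
      obtain v b where v: "v \<in> carrier_vec (p 0)" "b \<in> I" "g * e' $ j = e \<bullet> v + b"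
        unfolding p_def by (rule free_resolution_generates[OF P UNIV_I])
      have "e \<bullet> v - g * e' $ j = - b" unfolding v(3) by simp
      then have "e \<bullet> v - g * e' $ j \<in> I" using is_ideal_uminus[OF I v(2)] by metis
      then show ?thesis using v(1) by blast
    qed
    then obtain y where y: "\<And>j. y j \<in> carrier_vec (p 0)" "\<And>j. e \<bullet> y j - g * e' $ j \<in> I" by metis
    define X where "X = mat_of_cols (p 0) (map y [0..<q 0])"
    have X: "X \<in> carrier_mat (p 0) (q 0)" unfolding X_def by auto
    have colX: "col X j = y j" if "j < q 0" for j
      unfolding X_def using that y(1) by (subst col_mat_of_cols) auto
    have aug: "aug X"
      unfolding aug_def
    proof
      fix v :: "('a, 'b) mpoly vec" assume v: "v \<in> carrier_vec (q 0)"
      have "e \<bullet> (X *\<^sub>v v) - g * (e' \<bullet> v) = (\<Sum>j<q 0. v $ j * (e \<bullet> y j)) - g * (\<Sum>j<q 0. v $ j * e' $ j)"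
        unfolding scalar_prod_mult_mat_vec[OF Pc(3) X v]
        using colX v Qc(3) by (simp add: scalar_prod_def[of e'] atLeast0LessThan mult.commute)
      also have "\<dots> = (\<Sum>j<q 0. v $ j * (e \<bullet> y j - g * e' $ j))"
        by (simp add: sum_distrib_left sum_subtractf algebra_simps)
      also have "\<dots> \<in> I" using I y(2) by (intro is_ideal_sum) (auto simp: is_ideal_def)
      finally show "e \<bullet> (X *\<^sub>v v) - g * (e' \<bullet> v) \<in> I" .
    qed
    have "X * d' (Suc 0) *\<^sub>v v \<in> mat_range (d (Suc 0))" if v: "v \<in> carrier_vec (q (Suc 0))" for v
    proof -
      define w where "w = d' (Suc 0) *\<^sub>v v"
      have w: "w \<in> carrier_vec (q 0)" unfolding w_def using Qc(2)[of 0] v by auto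
      have "e' \<bullet> w \<in> I'"
        unfolding w_def using free_resolution_augment_comp[OF Q] v q_def by auto
      then have "e \<bullet> (X *\<^sub>v w) \<in> I"
        using g aug w I unfolding aug_def is_ideal_def by (metis diff_add_cancel)
      then have "X *\<^sub>v w \<in> mat_range (d (Suc 0))"
        using free_resolution_augment[OF P] X w unfolding p_def by auto
      then show ?thesis unfolding w_def using X Qc(2)[of 0] v
        by (simp add: assoc_mult_mat_vec[of _ "p 0" "q 0" _ "q (Suc 0)"])
    qed
    then show ?thesis using X aug unfolding ok_def by blast
  qed
  have step: "\<exists>Y. ok (Suc n) Y \<and> X * d' (Suc n) = d (Suc n) * Y" if X: "ok n X" for n X
  proof -
    have Xc: "X \<in> carrier_mat (p n) (q n)" using X unfolding ok_def by auto
    have "X * d' (Suc n) *\<^sub>v v \<in> mat_range (d (Suc n))" if "v \<in> carrier_vec (q (Suc n))" for v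
      using X that unfolding ok_def by blast
    then obtain Y where Y: "Y \<in> carrier_mat (p (Suc n)) (q (Suc n))" "X * d' (Suc n) = d (Suc n) * Y"
      by (rule mat_factor_through[OF mult_carrier_mat[OF Xc Qc(2)[of n]] Pc(2)[of n]])
    have "Y * d' (Suc (Suc n)) *\<^sub>v v \<in> mat_range (d (Suc (Suc n)))"
      if v: "v \<in> carrier_vec (q (Suc (Suc n)))" for v
    proof -
      define w where "w = d' (Suc (Suc n)) *\<^sub>v v"
      have w: "w \<in> carrier_vec (q (Suc n))" unfolding w_def using Qc(2)[of "Suc n"] v by auto
      have "d' (Suc n) *\<^sub>v w = (d' (Suc n) * d' (Suc (Suc n))) *\<^sub>v v"
        unfolding w_def using v Qc(2)[of n] Qc(2)[of "Suc n"] by auto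
      then have z: "d' (Suc n) *\<^sub>v w = 0\<^sub>v (q n)"
        using free_resolution_comp_zero[OF Q, folded q_def] v by (simp add: zero_mat_mult_vec)
      have "d (Suc n) *\<^sub>v (Y *\<^sub>v w) = (X * d' (Suc n)) *\<^sub>v w"
        unfolding Y(2) using Pc(2)[of n] Y(1) w by auto
      also have "\<dots> = X *\<^sub>v (d' (Suc n) *\<^sub>v w)" using Xc Qc(2)[of n] w by auto
      also have "\<dots> = 0\<^sub>v (p n)" unfolding z using Xc by auto
      finally have "Y *\<^sub>v w \<in> mat_range (d (Suc (Suc n)))"
        using Y(1) w by (intro free_resolution_exact[OF P]) (auto simp: p_def)
      then show ?thesis
        unfolding w_def using Y(1) Qc(2)[of "Suc n"] v by simp
    qed
    then show ?thesis using Y unfolding ok_def by auto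
  qed
  obtain \<phi> where \<phi>: "\<And>n. ok n (\<phi> n)" "\<And>n. \<phi> n * d' (Suc n) = d (Suc n) * \<phi> (Suc n)"
    using dependent_nat_choice[of ok "\<lambda>n X Y. X * d' (Suc n) = d (Suc n) * Y", OF base step] by blast
  show ?thesis
  proof (rule that[of \<phi>])
    show "\<phi> i \<in> carrier_mat (dim_col (d i)) (dim_col (d' i))" for i
      using \<phi>(1)[of i] unfolding ok_def p_def q_def by auto
    show "e \<bullet> (\<phi> 0 *\<^sub>v v) - g * (e' \<bullet> v) \<in> I" if "v \<in> carrier_vec (dim_col (d' 0))" for v
      using \<phi>(1)[of 0] that unfolding ok_def aug_def q_def by auto
  qed (rule \<phi>(2))
qed

text \<open>A chain map that lifts the zero map \<open>R/I' \<rightarrow> R/I\<close> is homotopic to zero. Given \<open>h n\<close>, the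
  remainder \<open>\<chi> (n + 1) - h n d'\<close> is what the next homotopy has to factor through \<open>d\<close>; it is killed by
  the preceding differential, so exactness applies.\<close>

lemma null_homotopy:
  assumes P: "free_resolution d e UNIV I" and Q: "free_resolution d' e' UNIV I'"
    and \<chi>: "\<And>i. \<chi> i \<in> carrier_mat (dim_col (d i)) (dim_col (d' i))"
    and chain: "\<And>i. \<chi> i * d' (Suc i) = d (Suc i) * \<chi> (Suc i)"
    and aug: "\<And>v. v \<in> carrier_vec (dim_col (d' 0)) \<Longrightarrow> e \<bullet> (\<chi> 0 *\<^sub>v v) \<in> I"
  obtains h where "\<And>i. h i \<in> carrier_mat (dim_col (d (Suc i))) (dim_col (d' i))"
    and "\<And>i. \<chi> (Suc i) = d (Suc (Suc i)) * h (Suc i) + h i * d' (Suc i)"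
proof -
  define p where "p i = dim_col (d i)" for i
  define q where "q i = dim_col (d' i)" for i
  note Pc = free_resolution_carrier[OF P, folded p_def]
  note Qc = free_resolution_carrier[OF Q, folded q_def]
  note \<chi>c = \<chi>[folded p_def q_def]
  define rem where "rem n X = \<chi> (Suc n) - X * d' (Suc n)" for n X
  have remc: "rem n X \<in> carrier_mat (p (Suc n)) (q (Suc n))" if "X \<in> carrier_mat (p (Suc n)) (q n)" for n X
    unfolding rem_def using that \<chi>c[of "Suc n"] Qc(2)[of n] by auto
  have rem_vec: "rem n X *\<^sub>v v = \<chi> (Suc n) *\<^sub>v v - X *\<^sub>v (d' (Suc n) *\<^sub>v v)"
    if "X \<in> carrier_mat (p (Suc n)) (q n)" "v \<in> carrier_vec (q (Suc n))" for n X v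
    unfolding rem_def using that \<chi>c[of "Suc n"] Qc(2)[of n]
    by (simp add: minus_mult_distrib_mat_vec[of _ "p (Suc n)" "q (Suc n)"])
  define ok where "ok n X \<longleftrightarrow> X \<in> carrier_mat (p (Suc n)) (q n) \<and>
      (\<forall>v\<in>carrier_vec (q (Suc n)). rem n X *\<^sub>v v \<in> mat_range (d (Suc (Suc n))))" for n X
  have ok_step: "ok n X"
    if X: "X \<in> carrier_mat (p (Suc n)) (q n)"
      and dX: "\<And>v. v \<in> carrier_vec (q (Suc n)) \<Longrightarrow>
        d (Suc n) *\<^sub>v (X *\<^sub>v (d' (Suc n) *\<^sub>v v)) = \<chi> n *\<^sub>v (d' (Suc n) *\<^sub>v v)" for n X
  proof -
    have "rem n X *\<^sub>v v \<in> mat_range (d (Suc (Suc n)))" if v: "v \<in> carrier_vec (q (Suc n))" for v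
    proof (rule free_resolution_exact[OF P], fold p_def)
      show "rem n X *\<^sub>v v \<in> carrier_vec (p (Suc n))" using remc[OF X] v by auto
      have w: "d' (Suc n) *\<^sub>v v \<in> carrier_vec (q n)" using Qc(2)[of n] v by auto
      have "\<chi> n *\<^sub>v (d' (Suc n) *\<^sub>v v) = (\<chi> n * d' (Suc n)) *\<^sub>v v" 
        using \<chi>c[of n] Qc(2)[of n] v by auto
      also have "\<dots> = d (Suc n) *\<^sub>v (\<chi> (Suc n) *\<^sub>v v)"
        unfolding chain using \<chi>c[of "Suc n"] Pc(2)[of n] v by auto
      finally have c: "d (Suc n) *\<^sub>v (\<chi> (Suc n) *\<^sub>v v) = \<chi> n *\<^sub>v (d' (Suc n) *\<^sub>v v)" by simp
      have "d (Suc n) *\<^sub>v (rem n X *\<^sub>v v)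
          = d (Suc n) *\<^sub>v (\<chi> (Suc n) *\<^sub>v v) - d (Suc n) *\<^sub>v (X *\<^sub>v (d' (Suc n) *\<^sub>v v))"
        unfolding rem_vec[OF X v] using Pc(2)[of n] \<chi>c[of "Suc n"] X v w
        by (intro mult_minus_distrib_mat_vec[of _ "p n" "p (Suc n)"]) auto
      also have "\<dots> = 0\<^sub>v (p n)"
        unfolding c dX[OF v] using \<chi>c[of n] w by (auto intro: minus_cancel_vec)
      finally show "d (Suc n) *\<^sub>v (rem n X *\<^sub>v v) = 0\<^sub>v (p n)" .
    qed
    then show ?thesis using X unfolding ok_def by auto
  qed
  have base: "\<exists>X. ok 0 X"
  proof -
    obtain X where X: "X \<in> carrier_mat (p (Suc 0)) (q 0)" "\<chi> 0 = d (Suc 0) * X"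
    proof (rule mat_factor_through[of "\<chi> 0" "p 0" "q 0" "d (Suc 0)" "p (Suc 0)"])
      show "\<chi> 0 *\<^sub>v v \<in> mat_range (d (Suc 0))" if "v \<in> carrier_vec (q 0)" for v
        using that aug[of v] \<chi>c[of 0]
        by (intro free_resolution_augment[OF P]) (auto simp: p_def q_def)
    qed (use \<chi>c[of 0] Pc(2)[of 0] in auto)
    have "ok 0 X"
    proof (rule ok_step[OF X(1)])
      show "d (Suc 0) *\<^sub>v (X *\<^sub>v (d' (Suc 0) *\<^sub>v v)) = \<chi> 0 *\<^sub>v (d' (Suc 0) *\<^sub>v v)"
        if v: "v \<in> carrier_vec (q (Suc 0))" for v
      proof -
        have "d' (Suc 0) *\<^sub>v v \<in> carrier_vec (q 0)" using Qc(2)[of 0] v by auto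
        then show ?thesis unfolding X(2) using X(1) Pc(2)[of 0] by auto
      qed
    qed
    then show ?thesis ..
  qed
  have step: "\<exists>Y. ok (Suc n) Y \<and> \<chi> (Suc n) = d (Suc (Suc n)) * Y + X * d' (Suc n)" if okX: "ok n X" for n X
  proof -
    have X: "X \<in> carrier_mat (p (Suc n)) (q n)" using okX unfolding ok_def by auto
    have "rem n X *\<^sub>v v \<in> mat_range (d (Suc (Suc n)))" if "v \<in> carrier_vec (q (Suc n))" for v
      using okX that unfolding ok_def by blast
    then obtain Y where Y: "Y \<in> carrier_mat (p (Suc (Suc n))) (q (Suc n))" "rem n X = d (Suc (Suc n)) * Y"
      by (rule mat_factor_through[OF remc[OF X] Pc(2)[of "Suc n"]])
    have "ok (Suc n) Y"
    proof (rule ok_step[OF Y(1)])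
      fix v :: "('a, 'b) mpoly vec" assume v: "v \<in> carrier_vec (q (Suc (Suc n)))"
      define w where "w = d' (Suc (Suc n)) *\<^sub>v v"
      have w: "w \<in> carrier_vec (q (Suc n))" unfolding w_def using Qc(2)[of "Suc n"] v by auto
      have "d' (Suc n) *\<^sub>v w = (d' (Suc n) * d' (Suc (Suc n))) *\<^sub>v v"
        unfolding w_def using v Qc(2)[of n] Qc(2)[of "Suc n"] by auto
      then have z: "d' (Suc n) *\<^sub>v w = 0\<^sub>v (q n)"
        using free_resolution_comp_zero[OF Q, folded q_def] v by (simp add: zero_mat_mult_vec)
      have "d (Suc (Suc n)) *\<^sub>v (Y *\<^sub>v w) = rem n X *\<^sub>v w"
        unfolding Y(2) using Pc(2)[of "Suc n"] Y(1) w by auto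
      also have "\<dots> = \<chi> (Suc n) *\<^sub>v w"
        unfolding rem_vec[OF X w] z using X \<chi>c[of "Suc n"] w by auto
      finally show "d (Suc (Suc n)) *\<^sub>v (Y *\<^sub>v (d' (Suc (Suc n)) *\<^sub>v v)) = \<chi> (Suc n) *\<^sub>v (d' (Suc (Suc n)) *\<^sub>v v)"
        unfolding w_def .
    qed
    moreover have "\<chi> (Suc n) = d (Suc (Suc n)) * Y + X * d' (Suc n)"
      unfolding Y(2)[symmetric] rem_def by (rule eq_matI) (use X \<chi>c[of "Suc n"] Qc(2)[of n] in auto)
    ultimately show ?thesis by blast
  qed
  obtain h where h: "\<And>n. ok n (h n)" "\<And>n. \<chi> (Suc n) = d (Suc (Suc n)) * h (Suc n) + h n * d' (Suc n)"
    using dependent_nat_choice[of ok "\<lambda>n X Y. \<chi> (Suc n) = d (Suc (Suc n)) * Y + X * d' (Suc n)",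
        OF base step] by blast
  show ?thesis
    by (rule that[of h]) (use h in \<open>auto simp: ok_def p_def q_def\<close>)
qed

section \<open>Independence of Tor from the resolution\<close>

lemma lookup_mult_sum:
  fixes p q :: "'a::monoid_add \<Rightarrow>\<^sub>0 'b::semiring_0"
  shows "Poly_Mapping.lookup (p * q) t =
    (\<Sum>s\<in>Poly_Mapping.keys p. \<Sum>u\<in>Poly_Mapping.keys q.
      (Poly_Mapping.lookup p s * Poly_Mapping.lookup q u when t = s + u))"
proof -
  have "(\<Sum>u. Poly_Mapping.lookup q u when t = s + u) = (\<Sum>u\<in>Poly_Mapping.keys q. (Poly_Mapping.lookup q u when t = s + u))" for s
    by (rule Sum_any.expand_superset) (auto simp: in_keys_iff)
  then have "Poly_Mapping.lookup (p * q) t = (\<Sum>s. Poly_Mapping.lookup p s * (\<Sum>u\<in>Poly_Mapping.keys q. (Poly_Mapping.lookup q u when t = s + u)))"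
    by (simp add: lookup_mult)
  also have "\<dots> = (\<Sum>s\<in>Poly_Mapping.keys p. Poly_Mapping.lookup p s * (\<Sum>u\<in>Poly_Mapping.keys q. (Poly_Mapping.lookup q u when t = s + u)))"
    by (rule Sum_any.expand_superset) (auto simp: in_keys_iff)
  finally show ?thesis by (simp add: sum_distrib_left mult_when)
qed

lemma poly_mapping_nat_add_eq_0_iff:
  "(s :: 'v \<Rightarrow>\<^sub>0 nat) + u = 0 \<longleftrightarrow> s = 0 \<and> u = 0"
  by (auto simp: poly_mapping_eq_iff fun_eq_iff lookup_add)

lemma const_term_mult:
  "Poly_Mapping.lookup ((p :: ('v, 'k::field) mpoly) * q) 0
    = Poly_Mapping.lookup p 0 * Poly_Mapping.lookup q 0"
proof -
  have "(\<Sum>s\<in>Poly_Mapping.keys p. \<Sum>u\<in>Poly_Mapping.keys q.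
      (Poly_Mapping.lookup p s * Poly_Mapping.lookup q u when 0 = s + u))
    = (\<Sum>s\<in>Poly_Mapping.keys p. if s = 0 then \<Sum>u\<in>Poly_Mapping.keys q.
        if u = 0 then Poly_Mapping.lookup p 0 * Poly_Mapping.lookup q 0 else 0 else 0)"
    by (intro sum.cong refl) (auto simp: when_def poly_mapping_nat_add_eq_0_iff eq_commute[of 0] intro!: sum.cong sum.neutral)
  also have "\<dots> = Poly_Mapping.lookup p 0 * Poly_Mapping.lookup q 0"
    by (simp add: in_keys_iff)
  finally show ?thesis unfolding lookup_mult_sum .
qed

lemma const_term_hom: "comm_ring_hom (\<lambda>p :: ('v, 'k::field) mpoly. Poly_Mapping.lookup p 0)"
  by unfold_locales (simp_all add: const_term_mult lookup_add lookup_one)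

lemma tensor_residue_field_carrier:
  "A \<in> carrier_mat n k \<Longrightarrow> tensor_residue_field A \<in> carrier_mat n k"
  unfolding tensor_residue_field_def by simp

lemma tensor_residue_field_mult:
  "A \<in> carrier_mat n k \<Longrightarrow> B \<in> carrier_mat k l \<Longrightarrow>
    tensor_residue_field (A * B) = tensor_residue_field A * tensor_residue_field B"
  unfolding tensor_residue_field_def
  by (rule semiring_hom.mat_hom_mult[OF ring_hom.axioms(1)[OF comm_ring_hom.axioms[OF const_term_hom]]])

lemma tensor_residue_field_add:
  "A \<in> carrier_mat n k \<Longrightarrow> B \<in> carrier_mat n k \<Longrightarrow>
    tensor_residue_field (A + B) = tensor_residue_field A + tensor_residue_field B"
  unfolding tensor_residue_field_def by (rule eq_matI) (auto simp: lookup_add)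

lemma tensor_residue_field_diff:
  "A \<in> carrier_mat n k \<Longrightarrow> B \<in> carrier_mat n k \<Longrightarrow>
    tensor_residue_field (A - B) = tensor_residue_field A - tensor_residue_field B"
  unfolding tensor_residue_field_def by (rule eq_matI) (auto simp: lookup_minus)

lemma tensor_residue_field_zero: "tensor_residue_field (0\<^sub>m n k) = 0\<^sub>m n k"
  unfolding tensor_residue_field_def by (rule eq_matI) auto

lemma tensor_residue_field_one: "tensor_residue_field (1\<^sub>m n) = 1\<^sub>m n"
  unfolding tensor_residue_field_def by (rule eq_matI) (auto simp: lookup_one)

text \<open>All entries lie in the ideal of the variables. A free resolution with this property is a
  minimal one: its differentials vanish over \<open>K\<close>, and its ranks are the Betti numbers.\<close>

definition minimal_entries :: "('v, 'k::field) mpoly mat \<Rightarrow> bool" where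
  "minimal_entries A \<longleftrightarrow> (\<forall>i<dim_row A. \<forall>j<dim_col A. Poly_Mapping.lookup (A $$ (i, j)) 0 = 0)"

lemma tensor_minimal_entries:
  "A \<in> carrier_mat n k \<Longrightarrow> minimal_entries A \<Longrightarrow> tensor_residue_field A = 0\<^sub>m n k"
  unfolding minimal_entries_def tensor_residue_field_def by (intro eq_matI) auto

text \<open>The comparison maps between two resolutions of \<open>R/I\<close> are inverse to each other up to
  homotopy, since \<open>\<phi> \<psi> - 1\<close> lifts zero.\<close>

lemma endomorphism_homotopic_id:
  assumes P: "free_resolution d e UNIV I" and Q: "free_resolution d' e' UNIV I" and I: "is_ideal I"
    and \<phi>c: "\<And>i. \<phi> i \<in> carrier_mat (dim_col (d i)) (dim_col (d' i))"
    and \<phi>: "\<And>i. \<phi> i * d' (Suc i) = d (Suc i) * \<phi> (Suc i)"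
    and \<phi>0: "\<And>v. v \<in> carrier_vec (dim_col (d' 0)) \<Longrightarrow> e \<bullet> (\<phi> 0 *\<^sub>v v) - e' \<bullet> v \<in> I"
    and \<psi>c: "\<And>i. \<psi> i \<in> carrier_mat (dim_col (d' i)) (dim_col (d i))"
    and \<psi>: "\<And>i. \<psi> i * d (Suc i) = d' (Suc i) * \<psi> (Suc i)"
    and \<psi>0: "\<And>v. v \<in> carrier_vec (dim_col (d 0)) \<Longrightarrow> e' \<bullet> (\<psi> 0 *\<^sub>v v) - e \<bullet> v \<in> I"
  obtains h where "\<And>i. h i \<in> carrier_mat (dim_col (d (Suc i))) (dim_col (d i))"
    and "\<And>i. \<phi> (Suc i) * \<psi> (Suc i) - 1\<^sub>m (dim_col (d (Suc i)))
      = d (Suc (Suc i)) * h (Suc i) + h i * d (Suc i)"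
proof -
  define \<chi> where "\<chi> i = \<phi> i * \<psi> i - 1\<^sub>m (dim_col (d i))" for i
  note Pc = free_resolution_carrier[OF P]
  note Qc = free_resolution_carrier[OF Q]
  have \<chi>c: "\<chi> i \<in> carrier_mat (dim_col (d i)) (dim_col (d i))" for i
    unfolding \<chi>_def by (intro minus_carrier_mat one_carrier_mat)
  have chain: "\<chi> i * d (Suc i) = d (Suc i) * \<chi> (Suc i)" for i
  proof -
    have "\<phi> i * \<psi> i * d (Suc i) = \<phi> i * (d' (Suc i) * \<psi> (Suc i))"
      unfolding \<psi>[symmetric] by (rule assoc_mult_mat[OF \<phi>c \<psi>c Pc(2)])
    also have "\<dots> = d (Suc i) * \<phi> (Suc i) * \<psi> (Suc i)"
      unfolding \<phi>[symmetric] by (rule assoc_mult_mat[OF \<phi>c Qc(2) \<psi>c, symmetric])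
    also have "\<dots> = d (Suc i) * (\<phi> (Suc i) * \<psi> (Suc i))"
      by (rule assoc_mult_mat[OF Pc(2) \<phi>c \<psi>c])
    finally have eq: "\<phi> i * \<psi> i * d (Suc i) = d (Suc i) * (\<phi> (Suc i) * \<psi> (Suc i))" .
    show ?thesis
      unfolding \<chi>_def minus_mult_distrib_mat[OF mult_carrier_mat[OF \<phi>c \<psi>c] one_carrier_mat Pc(2)]
        mult_minus_distrib_mat[OF Pc(2) mult_carrier_mat[OF \<phi>c \<psi>c] one_carrier_mat] eq
        left_mult_one_mat[OF Pc(2)] right_mult_one_mat[OF Pc(2)] ..
  qed
  have aug: "e \<bullet> (\<chi> 0 *\<^sub>v v) \<in> I" if v: "v \<in> carrier_vec (dim_col (d 0))" for v
  proof -
    have w: "\<psi> 0 *\<^sub>v v \<in> carrier_vec (dim_col (d' 0))" by (rule mult_mat_vec_carrier[OF \<psi>c v])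
    have "\<chi> 0 *\<^sub>v v = \<phi> 0 *\<^sub>v (\<psi> 0 *\<^sub>v v) - v"
      unfolding \<chi>_def minus_mult_distrib_mat_vec[OF mult_carrier_mat[OF \<phi>c \<psi>c] one_carrier_mat v]
        assoc_mult_mat_vec[OF \<phi>c \<psi>c v] one_mult_mat_vec[OF v] ..
    then have "e \<bullet> (\<chi> 0 *\<^sub>v v) = e \<bullet> (\<phi> 0 *\<^sub>v (\<psi> 0 *\<^sub>v v)) - e \<bullet> v"
      using scalar_prod_minus_distrib[OF Pc(3) mult_mat_vec_carrier[OF \<phi>c w] v] by simp
    also have "\<dots> = (e \<bullet> (\<phi> 0 *\<^sub>v (\<psi> 0 *\<^sub>v v)) - e' \<bullet> (\<psi> 0 *\<^sub>v v)) + (e' \<bullet> (\<psi> 0 *\<^sub>v v) - e \<bullet> v)"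
      by simp
    finally show ?thesis using \<phi>0[OF w] \<psi>0[OF v] I unfolding is_ideal_def by metis
  qed
  show ?thesis
    using null_homotopy[OF P P \<chi>c chain aug] that unfolding \<chi>_def by blast
qed

text \<open>Tor may be computed from any resolution: an arbitrary one is homotopy equivalent to a given
  minimal one, whose differentials vanish after tensoring with \<open>K\<close>. The homotopy on the minimal side
  then vanishes too, so over \<open>K\<close> the composite \<open>\<phi> \<psi>\<close> is the identity itself.\<close>

lemma tor_dim_eq_minimal_rank:
  assumes P: "free_resolution d e UNIV I" and M: "free_resolution d' e' UNIV I" and I: "is_ideal I"
    and min: "\<And>i. minimal_entries (d' i)"
  shows "tor_dim d (Suc n) = dim_col (d' (Suc n))"
proof -
  obtain \<phi> where \<phi>c: "\<And>i. \<phi> i \<in> carrier_mat (dim_col (d' i)) (dim_col (d i))"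
    and \<phi>: "\<And>i. \<phi> i * d (Suc i) = d' (Suc i) * \<phi> (Suc i)"
    and \<phi>0: "\<And>v. v \<in> carrier_vec (dim_col (d 0)) \<Longrightarrow> e' \<bullet> (\<phi> 0 *\<^sub>v v) - 1 * (e \<bullet> v) \<in> I"
    by (rule chain_map_lift[OF M P I, of 1]) (use I in auto)
  obtain \<psi> where \<psi>c: "\<And>i. \<psi> i \<in> carrier_mat (dim_col (d i)) (dim_col (d' i))"
    and \<psi>: "\<And>i. \<psi> i * d' (Suc i) = d (Suc i) * \<psi> (Suc i)"
    and \<psi>0: "\<And>v. v \<in> carrier_vec (dim_col (d' 0)) \<Longrightarrow> e \<bullet> (\<psi> 0 *\<^sub>v v) - 1 * (e' \<bullet> v) \<in> I"
    by (rule chain_map_lift[OF P M I, of 1]) (use I in auto)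
  obtain h where hc: "\<And>i. h i \<in> carrier_mat (dim_col (d (Suc i))) (dim_col (d i))"
    and h: "\<And>i. \<psi> (Suc i) * \<phi> (Suc i) - 1\<^sub>m (dim_col (d (Suc i)))
      = d (Suc (Suc i)) * h (Suc i) + h i * d (Suc i)"
    using endomorphism_homotopic_id[OF P M I \<psi>c \<psi> \<psi>0[unfolded mult_1_left] \<phi>c \<phi> \<phi>0[unfolded mult_1_left]]
    by blast
  obtain k where kc: "\<And>i. k i \<in> carrier_mat (dim_col (d' (Suc i))) (dim_col (d' i))"
    and k: "\<And>i. \<phi> (Suc i) * \<psi> (Suc i) - 1\<^sub>m (dim_col (d' (Suc i)))
      = d' (Suc (Suc i)) * k (Suc i) + k i * d' (Suc i)"
    using endomorphism_homotopic_id[OF M P I \<phi>c \<phi> \<phi>0[unfolded mult_1_left] \<psi>c \<psi> \<psi>0[unfolded mult_1_left]]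
    by blast
  note Pc = free_resolution_carrier(2)[OF P]
  note Mc = free_resolution_carrier(2)[OF M]
  note mult = tensor_residue_field_mult
  note car = tensor_residue_field_carrier
  let ?T = tensor_residue_field
  have T0: "?T (d' (Suc i)) = 0\<^sub>m (dim_col (d' i)) (dim_col (d' (Suc i)))" for i
    by (rule tensor_minimal_entries[OF Mc min])
  have "kernel_dim (?T (d (Suc n))) = vec_space.rank (dim_col (d (Suc n))) (?T (d (Suc (Suc n)))) + dim_col (d' (Suc n))"
  proof (rule kernel_dim_retract[OF car[OF Pc] car[OF Pc] car[OF \<phi>c] car[OF \<psi>c] car[OF hc] car[OF hc]])
    show "?T (d (Suc n)) * ?T (d (Suc (Suc n))) = 0\<^sub>m (dim_col (d n)) (dim_col (d (Suc (Suc n))))"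
      unfolding mult[OF Pc Pc, symmetric] free_resolution_comp_zero[OF P] tensor_residue_field_zero ..
    show "?T (\<phi> (Suc n)) * ?T (d (Suc (Suc n))) = 0\<^sub>m (dim_col (d' (Suc n))) (dim_col (d (Suc (Suc n))))"
      unfolding mult[OF \<phi>c Pc, symmetric] \<phi> mult[OF Mc \<phi>c] T0
      by (rule left_mult_zero_mat[OF car[OF \<phi>c]])
    show "?T (d (Suc n)) * ?T (\<psi> (Suc n)) = 0\<^sub>m (dim_col (d n)) (dim_col (d' (Suc n)))"
      unfolding mult[OF Pc \<psi>c, symmetric] \<psi>[symmetric] mult[OF \<psi>c Mc] T0
      by (rule right_mult_zero_mat[OF car[OF \<psi>c]])
    have "?T (\<phi> (Suc n)) * ?T (\<psi> (Suc n)) - 1\<^sub>m (dim_col (d' (Suc n)))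
        = ?T (\<phi> (Suc n) * \<psi> (Suc n) - 1\<^sub>m (dim_col (d' (Suc n))))"
      unfolding tensor_residue_field_diff[OF mult_carrier_mat[OF \<phi>c \<psi>c] one_carrier_mat]
        tensor_residue_field_one mult[OF \<phi>c \<psi>c] ..
    also have "\<dots> = 0\<^sub>m (dim_col (d' (Suc n))) (dim_col (d' (Suc n)))"
      unfolding k tensor_residue_field_add[OF mult_carrier_mat[OF Mc kc] mult_carrier_mat[OF kc Mc]]
        mult[OF Mc kc] mult[OF kc Mc] T0 
        left_mult_zero_mat[OF car[OF kc]] right_mult_zero_mat[OF car[OF kc]]
      by (rule left_add_zero_mat[OF zero_carrier_mat])
    finally have z: "?T (\<phi> (Suc n)) * ?T (\<psi> (Suc n)) - 1\<^sub>m (dim_col (d' (Suc n)))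
      = 0\<^sub>m (dim_col (d' (Suc n))) (dim_col (d' (Suc n)))" .
    show "?T (\<phi> (Suc n)) * ?T (\<psi> (Suc n)) = 1\<^sub>m (dim_col (d' (Suc n)))"
    proof (rule eq_matI)
      fix i j assume "i < dim_row (1\<^sub>m (dim_col (d' (Suc n))) :: 'b mat)" "j < dim_col (1\<^sub>m (dim_col (d' (Suc n))) :: 'b mat)"
      then have ij: "i < dim_col (d' (Suc n))" "j < dim_col (d' (Suc n))" by auto
      have "(?T (\<phi> (Suc n)) * ?T (\<psi> (Suc n)) - 1\<^sub>m (dim_col (d' (Suc n)))) $$ (i, j) = 0"
        unfolding z using ij by simp
      then show "(?T (\<phi> (Suc n)) * ?T (\<psi> (Suc n))) $$ (i, j) = 1\<^sub>m (dim_col (d' (Suc n))) $$ (i, j)"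
        using ij by (subst (asm) index_minus_mat(1)) auto
    qed (use car[OF \<phi>c[of "Suc n"]] car[OF \<psi>c[of "Suc n"]] in auto)
    show "?T (\<psi> (Suc n)) * ?T (\<phi> (Suc n)) - 1\<^sub>m (dim_col (d (Suc n)))
        = ?T (d (Suc (Suc n))) * ?T (h (Suc n)) + ?T (h n) * ?T (d (Suc n))"
    proof -
      have "?T (\<psi> (Suc n)) * ?T (\<phi> (Suc n)) - 1\<^sub>m (dim_col (d (Suc n)))
          = ?T (\<psi> (Suc n) * \<phi> (Suc n) - 1\<^sub>m (dim_col (d (Suc n))))"
        unfolding tensor_residue_field_diff[OF mult_carrier_mat[OF \<psi>c \<phi>c] one_carrier_mat]
          tensor_residue_field_one mult[OF \<psi>c \<phi>c] ..
      then show ?thesis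
        unfolding h tensor_residue_field_add[OF mult_carrier_mat[OF Pc hc] mult_carrier_mat[OF hc Pc]]
          mult[OF Pc hc] mult[OF hc Pc] .
    qed
  qed
  then show ?thesis
    unfolding tor_dim_def using carrier_matD(1)[OF Pc[of "Suc n"]] by simp
qed

section \<open>Mapping cones\<close>

text \<open>With \<open>I' = I : f\<close> there is an exact sequence
    \<open>0 \<rightarrow> R/I' \<rightarrow> R/I \<rightarrow> R/(I + (f)) \<rightarrow> 0\<close>
  whose first map is multiplication by \<open>f\<close>, and the cone over a lift of this map resolves the
  cokernel. The matrix \<open>d' 0\<close> has no rows, so the block matrix in degree 1 is just \<open>(d 1 | \<phi> 0)\<close>, and
  the exactness proof is the same in all degrees, except that in degree 1 injectivity of the
  multiplication takes the place of exactness of \<open>d'\<close>.\<close>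

lemma mapping_cone:
  assumes P: "free_resolution d e UNIV I" and Q: "free_resolution d' e' UNIV I'"
    and I: "is_ideal I" and I': "I' = {a. f * a \<in> I}"
    and \<phi>c: "\<And>i. \<phi> i \<in> carrier_mat (dim_col (d i)) (dim_col (d' i))"
    and \<phi>: "\<And>i. \<phi> i * d' (Suc i) = d (Suc i) * \<phi> (Suc i)"
    and \<phi>0: "\<And>v. v \<in> carrier_vec (dim_col (d' 0)) \<Longrightarrow> e \<bullet> (\<phi> 0 *\<^sub>v v) - f * (e' \<bullet> v) \<in> I"
    and D0: "D 0 = d 0"
    and DSuc: "\<And>i. D (Suc i) = four_block_mat (d (Suc i)) (\<phi> i)
      (0\<^sub>m (dim_row (d' i)) (dim_col (d (Suc i)))) (- d' i)"
  shows "free_resolution D e UNIV {a + r * f | a r. a \<in> I}"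
proof -
  define p where "p i = dim_col (d i)" for i
  define q where "q i = dim_col (d' i)" for i
  define s where "s i = dim_row (d' i)" for i
  note Pc = free_resolution_carrier[OF P, folded p_def]
  note Qc = free_resolution_carrier[OF Q, folded q_def]
  have Qsc: "d' i \<in> carrier_mat (s i) (q i)" for i unfolding s_def q_def by auto
  have s: "s 0 = 0" "s (Suc i) = q i" for i
    using Qc(1) Qc(2)[of i] unfolding s_def by auto
  note \<phi>c = \<phi>c[folded p_def q_def]
  have blk: "D (Suc i) *\<^sub>v (x @\<^sub>v y) = (d (Suc i) *\<^sub>v x + \<phi> i *\<^sub>v y) @\<^sub>v (- (d' i *\<^sub>v y))"
    if "x \<in> carrier_vec (p (Suc i))" "y \<in> carrier_vec (q i)" for i x y
  proof -
    have "0\<^sub>m (s i) (p (Suc i)) *\<^sub>v x + (- d' i) *\<^sub>v y = - (d' i *\<^sub>v y)"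
      unfolding zero_mat_mult_vec[OF that(1)]
      using that(2) Qsc[of i] by (subst uminus_mult_mat_vec) auto
    then show ?thesis
      unfolding DSuc s_def[symmetric] p_def[symmetric]
      by (subst four_block_mat_mult_vec[OF Pc(2) \<phi>c zero_carrier_mat uminus_carrier_mat[OF Qsc] that]) simp
  qed
  have Dc: "D (Suc i) \<in> carrier_mat (p i + s i) (p (Suc i) + q i)" for i
    unfolding DSuc by (rule four_block_carrier_mat[OF Pc(2) uminus_carrier_mat[OF Qsc]])
  have split: "\<exists>x y. x \<in> carrier_vec a \<and> y \<in> carrier_vec b \<and> v = x @\<^sub>v y"
    if "v \<in> carrier_vec (a + b)" for a b and v :: "('a, 'b) mpoly vec"
    using vec_first_last_append[OF that] vec_first_carrier vec_last_carrier by metis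
  have range_iff: "v \<in> mat_range (D (Suc i)) \<longleftrightarrow> (\<exists>x y. x \<in> carrier_vec (p (Suc i)) \<and> y \<in> carrier_vec (q i)
      \<and> v = (d (Suc i) *\<^sub>v x + \<phi> i *\<^sub>v y) @\<^sub>v (- (d' i *\<^sub>v y)))" (is "?l \<longleftrightarrow> ?r") for i v
  proof
    assume ?l
    then obtain u where u: "u \<in> carrier_vec (p (Suc i) + q i)" "v = D (Suc i) *\<^sub>v u"
      by (rule mat_rangeE[OF _ Dc])
    obtain x y where xy: "x \<in> carrier_vec (p (Suc i))" "y \<in> carrier_vec (q i)" "u = x @\<^sub>v y"
      using split[OF u(1)] by blast
    show ?r using blk[OF xy(1,2)] u(2) xy by blast
  next
    assume ?r
    then obtain x y where xy: "x \<in> carrier_vec (p (Suc i))" "y \<in> carrier_vec (q i)"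
      "v = (d (Suc i) *\<^sub>v x + \<phi> i *\<^sub>v y) @\<^sub>v (- (d' i *\<^sub>v y))" by blast
    show ?l using mat_rangeI[OF Dc append_carrier_vec[OF xy(1,2)]] unfolding blk[OF xy(1,2)] xy(3) .
  qed
  have d'd': "d' i *\<^sub>v (d' (Suc i) *\<^sub>v y) = 0\<^sub>v (s i)" if y: "y \<in> carrier_vec (q (Suc i))" for i y
  proof (cases i)
    case 0
    show ?thesis by (rule eq_vecI) (use 0 s(1) in \<open>auto simp: s_def\<close>)
  next
    case (Suc j)
    have "d' i *\<^sub>v (d' (Suc i) *\<^sub>v y) = (d' (Suc j) * d' (Suc (Suc j))) *\<^sub>v y"
      unfolding Suc by (rule assoc_mult_mat_vec[OF Qc(2) Qc(2) y[unfolded Suc], symmetric])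
    then show ?thesis
      unfolding free_resolution_comp_zero[OF Q, folded q_def] Suc s(2) zero_mat_mult_vec[OF y[unfolded Suc]] .
  qed
  have dd: "d (Suc i) *\<^sub>v (d (Suc (Suc i)) *\<^sub>v x) = 0\<^sub>v (p i)" if x: "x \<in> carrier_vec (p (Suc (Suc i)))" for i x
    using assoc_mult_mat_vec[OF Pc(2) Pc(2) x] 
    unfolding free_resolution_comp_zero[OF P, folded p_def] zero_mat_mult_vec[OF x] by simp
  have \<phi>d': "\<phi> i *\<^sub>v (d' (Suc i) *\<^sub>v y) = d (Suc i) *\<^sub>v (\<phi> (Suc i) *\<^sub>v y)"
    if y: "y \<in> carrier_vec (q (Suc i))" for i y
    using assoc_mult_mat_vec[OF \<phi>c Qc(2) y] assoc_mult_mat_vec[OF Pc(2) \<phi>c y] \<phi>[of i] by simp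
  have uminus_mult: "A *\<^sub>v (- v) = - (A *\<^sub>v v)" if "v \<in> carrier_vec k" "A \<in> carrier_mat n k"
    for A :: "('a, 'b) mpoly mat" and v n k
    by (rule eq_vecI) (use that in auto)
  have exact: "mat_kernel (D (Suc i)) = mat_range (D (Suc (Suc i)))" for i
  proof (intro equalityI subsetI)
    fix v assume "v \<in> mat_range (D (Suc (Suc i)))"
    then obtain x y where xy: "x \<in> carrier_vec (p (Suc (Suc i)))" "y \<in> carrier_vec (q (Suc i))"
      and v: "v = (d (Suc (Suc i)) *\<^sub>v x + \<phi> (Suc i) *\<^sub>v y) @\<^sub>v (- (d' (Suc i) *\<^sub>v y))"
      unfolding range_iff by blast
    define a where "a = d (Suc (Suc i)) *\<^sub>v x + \<phi> (Suc i) *\<^sub>v y"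
    define b where "b = d' (Suc i) *\<^sub>v y"
    have dx: "d (Suc (Suc i)) *\<^sub>v x \<in> carrier_vec (p (Suc i))" by (rule mult_mat_vec_carrier[OF Pc(2) xy(1)])
    have \<phi>y: "\<phi> (Suc i) *\<^sub>v y \<in> carrier_vec (p (Suc i))" by (rule mult_mat_vec_carrier[OF \<phi>c xy(2)])
    have a: "a \<in> carrier_vec (p (Suc i))" unfolding a_def by (rule add_carrier_vec[OF dx \<phi>y])
    have b: "b \<in> carrier_vec (q i)" unfolding b_def by (rule mult_mat_vec_carrier[OF Qc(2) xy(2)])
    have \<phi>b: "\<phi> i *\<^sub>v b \<in> carrier_vec (p i)" by (rule mult_mat_vec_carrier[OF \<phi>c b])
    have "d (Suc i) *\<^sub>v a = \<phi> i *\<^sub>v b"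
      unfolding a_def b_def \<phi>d'[OF xy(2)] mult_add_distrib_mat_vec[OF Pc(2) dx \<phi>y] dd[OF xy(1)]
      by (rule left_zero_vec[OF mult_mat_vec_carrier[OF Pc(2) \<phi>y]])
    then have "d (Suc i) *\<^sub>v a + \<phi> i *\<^sub>v (- b) = 0\<^sub>v (p i)"
      unfolding uminus_mult[OF b \<phi>c] using \<phi>b by simp
    moreover have "- (d' i *\<^sub>v (- b)) = 0\<^sub>v (s i)"
      unfolding uminus_mult[OF b Qsc] unfolding b_def d'd'[OF xy(2)] by simp
    ultimately have "D (Suc i) *\<^sub>v v = 0\<^sub>v (p i) @\<^sub>v 0\<^sub>v (s i)"
      unfolding v a_def[symmetric] b_def[symmetric]
      by (subst blk) (use a b in auto)
    also have "\<dots> = 0\<^sub>v (p i + s i)" by (rule eq_vecI) auto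
    finally show "v \<in> mat_kernel (D (Suc i))"
      using a b unfolding v a_def[symmetric] b_def[symmetric] by (intro mat_kernelI[OF Dc]) auto
  next
    fix v assume v: "v \<in> mat_kernel (D (Suc i))"
    note vk = mat_kernelD[OF Dc v]
    obtain x y where x: "x \<in> carrier_vec (p (Suc i))" and y: "y \<in> carrier_vec (q i)" and vxy: "v = x @\<^sub>v y"
      using split[OF vk(1)] by blast
    have dx: "d (Suc i) *\<^sub>v x \<in> carrier_vec (p i)" by (rule mult_mat_vec_carrier[OF Pc(2) x])
    have \<phi>y: "\<phi> i *\<^sub>v y \<in> carrier_vec (p i)" by (rule mult_mat_vec_carrier[OF \<phi>c y])
    have "(d (Suc i) *\<^sub>v x + \<phi> i *\<^sub>v y) @\<^sub>v (- (d' i *\<^sub>v y)) = 0\<^sub>v (p i) @\<^sub>v 0\<^sub>v (s i)"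
      using vk(2) unfolding vxy blk[OF x y] by (auto intro!: eq_vecI)
    then have eqs: "d (Suc i) *\<^sub>v x + \<phi> i *\<^sub>v y = 0\<^sub>v (p i)" "- (d' i *\<^sub>v y) = 0\<^sub>v (s i)"
      using append_vec_eq[OF add_carrier_vec[OF dx \<phi>y] zero_carrier_vec] by blast+
    have d'y: "d' i *\<^sub>v y = 0\<^sub>v (s i)"
      using eqs(2) uminus_zero_vec_eq[OF mult_mat_vec_carrier[OF Qsc y]] by simp
    have "y \<in> mat_range (d' (Suc i))"
    proof (cases i)
      \<comment> \<open>In degree 1 the kernel condition says \<open>f (e' \<bullet> y) \<in> I\<close>, that is \<open>e' \<bullet> y \<in> I : f\<close>.\<close>
      case 0
      have x0: "x \<in> carrier_vec (dim_col (d (Suc 0)))" and y0: "y \<in> carrier_vec (dim_col (d' 0))"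
        using x y unfolding 0 p_def q_def .
      have "e \<bullet> (d (Suc 0) *\<^sub>v x) + e \<bullet> (\<phi> 0 *\<^sub>v y) = e \<bullet> 0\<^sub>v (p 0)"
        unfolding eqs(1)[unfolded 0, symmetric]
        by (rule scalar_prod_add_distrib[OF Pc(3) dx[unfolded 0] \<phi>y[unfolded 0], symmetric])
      then have "e \<bullet> (\<phi> 0 *\<^sub>v y) = - (e \<bullet> (d (Suc 0) *\<^sub>v x))"
        using Pc(3) by (simp add: eq_neg_iff_add_eq_0 add.commute)
      then have "e \<bullet> (\<phi> 0 *\<^sub>v y) \<in> I"
        using is_ideal_uminus[OF I free_resolution_augment_comp[OF P x0]] by simp
      then have "f * (e' \<bullet> y) \<in> I" using is_ideal_diff[OF I _ \<phi>0[OF y0]] by fastforce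
      then have "e' \<bullet> y \<in> I'" unfolding I' by simp
      then show ?thesis unfolding 0 by (rule free_resolution_augment[OF Q y0])
    next
      case (Suc j)
      show ?thesis unfolding Suc
        by (rule free_resolution_exact[OF Q, folded q_def]) 
          (use y d'y in \<open>simp_all only: Suc s(2)\<close>)
    qed
    then obtain z where z: "z \<in> carrier_vec (q (Suc i))" "y = d' (Suc i) *\<^sub>v z"
      by (rule mat_rangeE[OF _ Qc(2)])
    have \<phi>z: "\<phi> (Suc i) *\<^sub>v z \<in> carrier_vec (p (Suc i))" by (rule mult_mat_vec_carrier[OF \<phi>c z(1)])
    have "d (Suc i) *\<^sub>v (x + \<phi> (Suc i) *\<^sub>v z) = d (Suc i) *\<^sub>v x + \<phi> i *\<^sub>v y"
      unfolding z(2) \<phi>d'[OF z(1)] by (rule mult_add_distrib_mat_vec[OF Pc(2) x \<phi>z])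
    then have "x + \<phi> (Suc i) *\<^sub>v z \<in> mat_range (d (Suc (Suc i)))"
      unfolding eqs(1) 
      by (intro free_resolution_exact[OF P, folded p_def] add_carrier_vec x \<phi>z)
    then obtain u where u: "u \<in> carrier_vec (p (Suc (Suc i)))" "x + \<phi> (Suc i) *\<^sub>v z = d (Suc (Suc i)) *\<^sub>v u"
      by (rule mat_rangeE[OF _ Pc(2)])
    have "d (Suc (Suc i)) *\<^sub>v u + \<phi> (Suc i) *\<^sub>v (- z) = x"
      unfolding u(2)[symmetric] uminus_mult[OF z(1) \<phi>c] by (rule eq_vecI) (use x \<phi>z in auto)
    moreover have "- (d' (Suc i) *\<^sub>v (- z)) = y"
      unfolding uminus_mult[OF z(1) Qc(2)] z(2) by (rule eq_vecI) auto
    ultimately show "v \<in> mat_range (D (Suc (Suc i)))"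
      unfolding range_iff vxy using u(1) z(1) by (intro exI[of _ u] exI[of _ "- z"]) auto
  qed
  have aug: "{v \<in> carrier_vec (p 0). e \<bullet> v \<in> {a + r * f | a r. a \<in> I}} = mat_range (D (Suc 0))"
  proof (intro equalityI subsetI)
    fix v assume "v \<in> {v \<in> carrier_vec (p 0). e \<bullet> v \<in> {a + r * f | a r. a \<in> I}}"
    then obtain a r where v: "v \<in> carrier_vec (p 0)" and ev: "e \<bullet> v = a + r * f" and a: "a \<in> I" by auto
    obtain y b where y: "y \<in> carrier_vec (q 0)" and b: "b \<in> I'" and r: "r = e' \<bullet> y + b"
      unfolding q_def by (rule free_resolution_generates[OF Q UNIV_I])
    have \<phi>y: "\<phi> 0 *\<^sub>v y \<in> carrier_vec (p 0)" by (rule mult_mat_vec_carrier[OF \<phi>c y])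
    have "e \<bullet> (v - \<phi> 0 *\<^sub>v y) = e \<bullet> v - e \<bullet> (\<phi> 0 *\<^sub>v y)"
      by (rule scalar_prod_minus_distrib[OF Pc(3) v \<phi>y])
    also have "\<dots> = (a + f * b) - (e \<bullet> (\<phi> 0 *\<^sub>v y) - f * (e' \<bullet> y))"
      unfolding ev r by (simp add: algebra_simps)
    also have "\<dots> \<in> I"
    proof (rule is_ideal_diff[OF I])
      show "a + f * b \<in> I" using a b I unfolding I' is_ideal_def by simp
    qed (rule \<phi>0, use y q_def in simp)
    finally have "v - \<phi> 0 *\<^sub>v y \<in> mat_range (d (Suc 0))"
      using v \<phi>y by (intro free_resolution_augment[OF P, folded p_def]) auto
    then obtain x where x: "x \<in> carrier_vec (p (Suc 0))" "v - \<phi> 0 *\<^sub>v y = d (Suc 0) *\<^sub>v x"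
      by (rule mat_rangeE[OF _ Pc(2)])
    have "v = (d (Suc 0) *\<^sub>v x + \<phi> 0 *\<^sub>v y) @\<^sub>v (- (d' 0 *\<^sub>v y))"
      unfolding x(2)[symmetric] by (rule eq_vecI) (use v carrier_vecD[OF \<phi>y] \<phi>c[of 0] Qc(1) in auto)
    then show "v \<in> mat_range (D (Suc 0))" unfolding range_iff using x(1) y by blast
  next
    fix v assume "v \<in> mat_range (D (Suc 0))"
    then obtain x y where x: "x \<in> carrier_vec (p (Suc 0))" and y: "y \<in> carrier_vec (q 0)"
      and v: "v = (d (Suc 0) *\<^sub>v x + \<phi> 0 *\<^sub>v y) @\<^sub>v (- (d' 0 *\<^sub>v y))"
      unfolding range_iff by blast
    have dx: "d (Suc 0) *\<^sub>v x \<in> carrier_vec (p 0)" by (rule mult_mat_vec_carrier[OF Pc(2) x])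
    have \<phi>y: "\<phi> 0 *\<^sub>v y \<in> carrier_vec (p 0)" by (rule mult_mat_vec_carrier[OF \<phi>c y])
    have veq: "v = d (Suc 0) *\<^sub>v x + \<phi> 0 *\<^sub>v y"
      unfolding v by (rule eq_vecI) (use dx \<phi>y \<phi>c[of 0] Qc(1) in auto)
    have "e \<bullet> v = e \<bullet> (d (Suc 0) *\<^sub>v x) + e \<bullet> (\<phi> 0 *\<^sub>v y)"
      unfolding veq by (rule scalar_prod_add_distrib[OF Pc(3) dx \<phi>y])
    also have "\<dots> = (e \<bullet> (d (Suc 0) *\<^sub>v x) + (e \<bullet> (\<phi> 0 *\<^sub>v y) - f * (e' \<bullet> y))) + (e' \<bullet> y) * f"
      by (simp add: algebra_simps)
    finally have ev: "e \<bullet> v = (e \<bullet> (d (Suc 0) *\<^sub>v x) + (e \<bullet> (\<phi> 0 *\<^sub>v y) - f * (e' \<bullet> y))) + (e' \<bullet> y) * f" .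
    have "e \<bullet> (d (Suc 0) *\<^sub>v x) \<in> I" using free_resolution_augment_comp[OF P] x unfolding p_def by blast
    moreover have "e \<bullet> (\<phi> 0 *\<^sub>v y) - f * (e' \<bullet> y) \<in> I" using \<phi>0 y unfolding q_def by blast
    ultimately have inI: "e \<bullet> (d (Suc 0) *\<^sub>v x) + (e \<bullet> (\<phi> 0 *\<^sub>v y) - f * (e' \<bullet> y)) \<in> I"
      using I unfolding is_ideal_def by blast
    then show "v \<in> {v \<in> carrier_vec (p 0). e \<bullet> v \<in> {a + r * f | a r. a \<in> I}}"
    proof -
      have "v \<in> carrier_vec (p 0)" unfolding veq by (rule add_carrier_vec[OF dx \<phi>y])
      then show ?thesis using inI ev by blast
    qed
  qed
  have gen: "{e \<bullet> v + a |v a. v \<in> carrier_vec (p 0) \<and> a \<in> {a + r * f | a r. a \<in> I}} = UNIV"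
  proof -
    have "\<exists>v b. c = e \<bullet> v + b \<and> v \<in> carrier_vec (p 0) \<and> b \<in> {a + r * f | a r. a \<in> I}" for c
    proof -
      obtain v b where vb: "v \<in> carrier_vec (p 0)" "b \<in> I" "c = e \<bullet> v + b"
        unfolding p_def by (rule free_resolution_generates[OF P UNIV_I])
      have "b = b + 0 * f" by simp
      then show ?thesis using vb by blast
    qed
    then show ?thesis by blast
  qed
  have dimD: "dim_col (D 0) = p 0" "dim_col (D (Suc i)) = p (Suc i) + q i" for i
    using carrier_matD(2)[OF Dc] D0 p_def by auto
  have rowD: "dim_row (D (Suc i)) = dim_col (D i)" for i
    by (cases i) (use carrier_matD(1)[OF Dc] s dimD in \<open>simp_all\<close>)
  show ?thesis
    unfolding free_resolution_def dimD(1) One_nat_def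
    using exact aug gen rowD Pc(1,3) D0 by simp
qed

definition has_minimal_resolution :: "('v, 'k::field) mpoly set \<Rightarrow> (nat \<Rightarrow> nat) \<Rightarrow> bool" where
  "has_minimal_resolution I b \<longleftrightarrow> (\<exists>d e. free_resolution d e UNIV I \<and>
     (\<forall>i. minimal_entries (d i)) \<and> (\<forall>i. dim_col (d i) = b i))"

lemma betti_eq:
  assumes "has_minimal_resolution I b" "is_ideal I"
  shows "betti UNIV I (Suc n) = b (Suc n)"
proof -
  obtain d' e' where M: "free_resolution d' e' UNIV I" "\<And>i. minimal_entries (d' i)" "\<And>i. dim_col (d' i) = b i"
    using assms unfolding has_minimal_resolution_def by blast
  define x where "x = (SOME (d, e). free_resolution d e UNIV I)"
  have "case x of (d, e) \<Rightarrow> free_resolution d e UNIV I"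
    unfolding x_def by (rule someI_ex) (use M(1) in auto)
  then have "free_resolution (fst x) (snd x) UNIV I" by (cases x) simp
  then show ?thesis
    unfolding betti_def x_def[symmetric] using tor_dim_eq_minimal_rank[OF _ M(1) assms(2) M(2)] M(3) by metis
qed

text \<open>The crucial point is that the cone stays minimal. If \<open>g (I : g x) \<subseteq> I\<close>, multiplication by \<open>g x\<close>
  factors through multiplication by \<open>g\<close>, so \<open>x\<close> times an arbitrary lift of the latter is a lift of the
  former; its entries are multiples of \<open>x\<close> and have no constant term. In this way minimality holds
  without any control on the degrees of the lift.\<close>

lemma has_minimal_resolution_add_generator:
  assumes P: "has_minimal_resolution I b" and Q: "has_minimal_resolution {a. g * x * a \<in> I} c"
    and I: "is_ideal I" and x: "Poly_Mapping.lookup x 0 = 0"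
    and g: "\<And>a. g * x * a \<in> I \<Longrightarrow> g * a \<in> I"
  shows "has_minimal_resolution {a + r * (g * x) | a r. a \<in> I}
    (\<lambda>i. b i + (case i of 0 \<Rightarrow> 0 | Suc j \<Rightarrow> c j))"
proof -
  obtain d e where d: "free_resolution d e UNIV I" "\<And>i. minimal_entries (d i)" "\<And>i. dim_col (d i) = b i"
    using P unfolding has_minimal_resolution_def by blast
  obtain d' e' where d': "free_resolution d' e' UNIV {a. g * x * a \<in> I}" "\<And>i. minimal_entries (d' i)"
    "\<And>i. dim_col (d' i) = c i"
    using Q unfolding has_minimal_resolution_def by blast
  obtain \<phi> where \<phi>c: "\<And>i. \<phi> i \<in> carrier_mat (dim_col (d i)) (dim_col (d' i))"
    and \<phi>: "\<And>i. \<phi> i * d' (Suc i) = d (Suc i) * \<phi> (Suc i)"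
    and \<phi>0: "\<And>v. v \<in> carrier_vec (dim_col (d' 0)) \<Longrightarrow> e \<bullet> (\<phi> 0 *\<^sub>v v) - g * (e' \<bullet> v) \<in> I"
    by (rule chain_map_lift[OF d(1) d'(1) I, of g]) (use g in auto)
  define \<psi> where "\<psi> i = x \<cdot>\<^sub>m \<phi> i" for i
  have \<psi>c: "\<psi> i \<in> carrier_mat (dim_col (d i)) (dim_col (d' i))" for i
    unfolding \<psi>_def using \<phi>c by simp
  note Pc = free_resolution_carrier[OF d(1)]
  note Qc = free_resolution_carrier[OF d'(1)]
  have \<psi>: "\<psi> i * d' (Suc i) = d (Suc i) * \<psi> (Suc i)" for i
    unfolding \<psi>_def mult_smult_distrib[OF Pc(2) \<phi>c] mult_smult_assoc_mat[OF \<phi>c Qc(2)] \<phi> ..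
  have \<psi>0: "e \<bullet> (\<psi> 0 *\<^sub>v v) - g * x * (e' \<bullet> v) \<in> I" if v: "v \<in> carrier_vec (dim_col (d' 0))" for v
  proof -
    have "\<psi> 0 *\<^sub>v v = x \<cdot>\<^sub>v (\<phi> 0 *\<^sub>v v)"
      unfolding \<psi>_def by (rule eq_vecI) (use \<phi>c[of 0] v in \<open>auto simp: row_smult\<close>)
    then have "e \<bullet> (\<psi> 0 *\<^sub>v v) = x * (e \<bullet> (\<phi> 0 *\<^sub>v v))"
      using scalar_prod_smult_distrib[OF Pc(3) mult_mat_vec_carrier[OF \<phi>c v]] by simp
    then have "e \<bullet> (\<psi> 0 *\<^sub>v v) - g * x * (e' \<bullet> v) = x * (e \<bullet> (\<phi> 0 *\<^sub>v v) - g * (e' \<bullet> v))"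
      by (simp add: algebra_simps)
    then show ?thesis using \<phi>0[OF v] I unfolding is_ideal_def by metis
  qed
  have min\<psi>: "minimal_entries (\<psi> i)" for i
    unfolding minimal_entries_def \<psi>_def using x by (auto simp: const_term_mult)
  define D where "D i = (case i of 0 \<Rightarrow> d 0 | Suc j \<Rightarrow> four_block_mat (d (Suc j)) (\<psi> j)
      (0\<^sub>m (dim_row (d' j)) (dim_col (d (Suc j)))) (- d' j))" for i
  have D: "D 0 = d 0" "\<And>j. D (Suc j) = four_block_mat (d (Suc j)) (\<psi> j)
      (0\<^sub>m (dim_row (d' j)) (dim_col (d (Suc j)))) (- d' j)"
    unfolding D_def by simp_all
  have res: "free_resolution D e UNIV {a + r * (g * x) | a r. a \<in> I}"
    by (rule mapping_cone[OF d(1) d'(1) I refl \<psi>c \<psi> \<psi>0 D])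
  have dims: "dim_col (D i) = b i + (case i of 0 \<Rightarrow> 0 | Suc j \<Rightarrow> c j)" for i
    by (cases i) (simp_all add: D d(3) d'(3))
  have "minimal_entries (D i)" for i
  proof (cases i)
    case 0
    then show ?thesis using d(2) D(1) by simp
  next
    case (Suc j)
    have "dim_row (d (Suc j)) = dim_row (\<psi> j)" "dim_col (\<psi> j) = dim_col (d' j)"
      using Pc(2)[of j] \<psi>c[of j] by auto
    then show ?thesis
      using d(2)[of "Suc j"] d'(2)[of j] min\<psi>[of j] unfolding Suc D(2) minimal_entries_def by auto
  qed
  then show ?thesis unfolding has_minimal_resolution_def using res dims by blast
qed

lemma has_minimal_resolution_zero:
  "has_minimal_resolution ({0} :: ('v, 'k::field) mpoly set) (\<lambda>i. if i = 0 then 1 else 0)"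
proof -
  define d :: "nat \<Rightarrow> ('v, 'k) mpoly mat" where
    "d i = 0\<^sub>m (if i = 1 then 1 else 0) (if i = 0 then 1 else 0)" for i
  define e :: "('v, 'k) mpoly vec" where "e = vec 1 (\<lambda>_. 1)"
  have ev: "e \<bullet> v = v $ 0" if "v \<in> carrier_vec 1" for v
    unfolding e_def scalar_prod_def using that by simp
  have rng: "mat_range (d (Suc i)) = {0\<^sub>v (if i = 0 then 1 else 0)}" for i
  proof -
    have "carrier_vec 0 = {0\<^sub>v 0 :: ('v, 'k) mpoly vec}" by auto
    moreover have "(0\<^sub>m n 0 :: ('v, 'k) mpoly mat) *\<^sub>v 0\<^sub>v 0 = 0\<^sub>v n" for n
      by (rule zero_mat_mult_vec) simp
    ultimately show ?thesis unfolding mat_range_def d_def by simp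
  qed
  have ker: "mat_kernel (d (Suc i)) = {0\<^sub>v 0}" for i
    unfolding mat_kernel_def d_def by (auto intro!: eq_vecI)
  have gen: "\<exists>v. c = e \<bullet> v \<and> v \<in> carrier_vec 1" for c
    using ev[of "vec 1 (\<lambda>_. c)"] by (intro exI[of _ "vec 1 (\<lambda>_. c)"]) simp
  have aug: "{v \<in> carrier_vec 1. e \<bullet> v = 0} = {0\<^sub>v 1}"
    using ev by (auto intro!: eq_vecI)
  have "free_resolution d e UNIV {0}"
    unfolding free_resolution_def One_nat_def
  proof (intro conjI allI)
    show "mat_kernel (d (Suc i)) = mat_range (d (Suc (Suc i)))" for i unfolding ker rng by simp
    show "{e \<bullet> v + a |v a. v \<in> carrier_vec (dim_col (d 0)) \<and> a \<in> {0}} = UNIV"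
      using gen by (auto simp: d_def)
    show "{v \<in> carrier_vec (dim_col (d 0)). e \<bullet> v \<in> {0}} = mat_range (d (Suc 0))"
      unfolding rng using aug by (simp add: d_def)
  qed (auto simp: d_def e_def)
  moreover have "minimal_entries (d i)" for i unfolding minimal_entries_def d_def by auto
  moreover have "dim_col (d i) = (if i = 0 then 1 else 0)" for i unfolding d_def by simp
  ultimately show ?thesis unfolding has_minimal_resolution_def by blast
qed

section \<open>Squarefree monomial ideals\<close>

definition sqfree_exponent :: "'v::finite set \<Rightarrow> ('v \<Rightarrow>\<^sub>0 nat)" where
  "sqfree_exponent F = (\<Sum>v\<in>F. Poly_Mapping.single v 1)"

abbreviation monomial :: "('v \<Rightarrow>\<^sub>0 nat) \<Rightarrow> ('v, 'k::field) mpoly" where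
  "monomial t \<equiv> Poly_Mapping.single t 1"

lemma lookup_sqfree_exponent:
  "Poly_Mapping.lookup (sqfree_exponent F) v = (if v \<in> F then 1 else 0)"
  unfolding sqfree_exponent_def by (auto simp: lookup_sum lookup_single when_def)

lemma keys_sqfree_exponent [simp]: "Poly_Mapping.keys (sqfree_exponent F) = F"
  by (auto simp: in_keys_iff lookup_sqfree_exponent split: if_splits)

lemma sqfree_exponent_inject [simp]: "sqfree_exponent F = sqfree_exponent G \<longleftrightarrow> F = G"
  by (metis keys_sqfree_exponent)

lemma keys_add_nat:
  "Poly_Mapping.keys (s + t :: 'v \<Rightarrow>\<^sub>0 nat) = Poly_Mapping.keys s \<union> Poly_Mapping.keys t"
  by (auto simp: in_keys_iff lookup_add)

lemma sqfree_exponent_Un_disjoint: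
  "F \<inter> G = {} \<Longrightarrow> sqfree_exponent (F \<union> G) = sqfree_exponent F + sqfree_exponent G"
  by (rule poly_mapping_eqI) (auto simp: lookup_add lookup_sqfree_exponent)

lemma prod_Var_eq_monomial: "(\<Prod>v\<in>F. Var v) = monomial (sqfree_exponent F)"
proof -
  have "finite F" by simp
  then show ?thesis
    unfolding sqfree_exponent_def Var_def
    by (induction F) (simp_all add: mult_single flip: single_one)
qed

lemma sqfree_exponent_divides:
  assumes "F \<subseteq> Poly_Mapping.keys t"
  obtains u where "t = u + sqfree_exponent F"
proof
  show "t = (t - sqfree_exponent F) + sqfree_exponent F"
  proof (rule poly_mapping_eqI)
    fix v
    have "Poly_Mapping.lookup t v \<ge> 1" if "v \<in> F"
      using assms that by (force simp: in_keys_iff)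
    then show "Poly_Mapping.lookup t v = Poly_Mapping.lookup (t - sqfree_exponent F + sqfree_exponent F) v"
      by (auto simp: lookup_add lookup_minus lookup_sqfree_exponent)
  qed
qed

text \<open>A monomial is a multiple of the squarefree monomial with support \<open>F\<close> iff its own support
  contains \<open>F\<close>. This describes the ideal generated by such monomials through supports only.\<close>

definition sqfree_ideal :: "'v::finite set set \<Rightarrow> ('v, 'k::field) mpoly set" where
  "sqfree_ideal S = {p. \<forall>t\<in>Poly_Mapping.keys p. \<exists>F\<in>S. F \<subseteq> Poly_Mapping.keys t}"

lemma is_ideal_sqfree_ideal: "is_ideal (sqfree_ideal S)"
  unfolding is_ideal_def
proof (intro conjI ballI allI)
  show "0 \<in> sqfree_ideal S" unfolding sqfree_ideal_def by simp
  fix a b :: "('a, 'b) mpoly" assume a: "a \<in> sqfree_ideal S"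
  show "a + b \<in> sqfree_ideal S" if "b \<in> sqfree_ideal S"
    using a that Poly_Mapping.keys_add[of a b] unfolding sqfree_ideal_def by blast
  show "b * a \<in> sqfree_ideal S"
    unfolding sqfree_ideal_def
  proof (intro CollectI ballI)
    fix t assume "t \<in> Poly_Mapping.keys (b * a)"
    then obtain x y where t: "t = x + y" and y: "y \<in> Poly_Mapping.keys a"
      using keys_mult[of b a] by blast
    obtain F where "F \<in> S" "F \<subseteq> Poly_Mapping.keys y"
      using a y unfolding sqfree_ideal_def by blast
    then show "\<exists>F\<in>S. F \<subseteq> Poly_Mapping.keys t"
      unfolding t keys_add_nat by blast
  qed
qed

lemma monomial_in_sqfree_ideal_iff:
  "(monomial t :: ('v::finite, 'k::field) mpoly) \<in> sqfree_ideal S \<longleftrightarrow> (\<exists>F\<in>S. F \<subseteq> Poly_Mapping.keys t)"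
  unfolding sqfree_ideal_def by simp

lemma sum_of_terms:
  "p = (\<Sum>t\<in>Poly_Mapping.keys p. Poly_Mapping.single t (Poly_Mapping.lookup p t))"
  by (rule poly_mapping_eqI) (auto simp: lookup_sum lookup_single when_def in_keys_iff)

lemma in_ideal_if_monomials:
  fixes p :: "('v, 'k::field) mpoly"
  assumes J: "is_ideal J" and mon: "\<And>t. t \<in> Poly_Mapping.keys p \<Longrightarrow> monomial t \<in> J"
  shows "p \<in> J"
proof -
  have "Poly_Mapping.single t c \<in> J" if "monomial t \<in> J" for t and c :: 'k
  proof -
    have "Poly_Mapping.single t c = Poly_Mapping.single 0 c * monomial t" by (simp add: mult_single)
    then show ?thesis using J that unfolding is_ideal_def by metis
  qed
  then have "(\<Sum>t\<in>Poly_Mapping.keys p. Poly_Mapping.single t (Poly_Mapping.lookup p t)) \<in> J"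
    by (intro is_ideal_sum[OF J]) (use mon in blast)
  then show ?thesis by (subst sum_of_terms)
qed

lemma is_ideal_add_generator:
  assumes I: "is_ideal I"
  shows "is_ideal {a + r * f | a r. a \<in> I}"
  unfolding is_ideal_def
proof (intro conjI ballI allI)
  have "0 \<in> I" using I unfolding is_ideal_def by blast
  then show "0 \<in> {a + r * f | a r. a \<in> I}" by (intro CollectI exI[of _ 0]) auto
  fix x assume "x \<in> {a + r * f | a r. a \<in> I}"
  then obtain a r where x: "x = a + r * f" "a \<in> I" by auto
  show "x + y \<in> {a + r * f | a r. a \<in> I}" if "y \<in> {a + r * f | a r. a \<in> I}" for y
  proof -
    obtain b s where y: "y = b + s * f" "b \<in> I" using \<open>y \<in> _\<close> by auto
    have "x + y = (a + b) + (r + s) * f" unfolding x y by (simp add: algebra_simps)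
    moreover have "a + b \<in> I" using I x y unfolding is_ideal_def by blast
    ultimately show ?thesis by blast
  qed
  show "s * x \<in> {a + r * f | a r. a \<in> I}" for s
  proof -
    have "s * x = s * a + (s * r) * f" unfolding x by (simp add: algebra_simps)
    moreover have "s * a \<in> I" using I x unfolding is_ideal_def by blast
    ultimately show ?thesis by blast
  qed
qed

lemma sqfree_ideal_insert:
  "sqfree_ideal (insert F S) = {a + r * monomial (sqfree_exponent F) | a r. a \<in> sqfree_ideal S}"
    (is "?L = ?R")
proof (intro equalityI subsetI)
  fix p assume p: "p \<in> ?L"
  show "p \<in> ?R"
  proof (rule in_ideal_if_monomials[OF is_ideal_add_generator[OF is_ideal_sqfree_ideal]])
    fix t assume "t \<in> Poly_Mapping.keys p"
    then consider "\<exists>H\<in>S. H \<subseteq> Poly_Mapping.keys t" | "F \<subseteq> Poly_Mapping.keys t"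
      using p unfolding sqfree_ideal_def by auto
    then show "monomial t \<in> ?R"
    proof cases
      case 1
      then have "(monomial t :: ('a, 'b) mpoly) \<in> sqfree_ideal S" unfolding monomial_in_sqfree_ideal_iff .
      then show ?thesis by (intro CollectI exI[of _ "monomial t"] exI[of _ 0]) simp
    next
      case 2
      then obtain u where "t = u + sqfree_exponent F" by (rule sqfree_exponent_divides)
      then have "monomial t = 0 + monomial u * monomial (sqfree_exponent F)" by (simp add: mult_single)
      moreover have "0 \<in> sqfree_ideal S" unfolding sqfree_ideal_def by simp
      ultimately show ?thesis by blast
    qed
  qed
next
  fix p assume "p \<in> ?R"
  then obtain a r where p: "p = a + r * monomial (sqfree_exponent F)" and a: "a \<in> sqfree_ideal S" by auto
  have "a \<in> ?L" using a unfolding sqfree_ideal_def by auto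
  moreover have "(monomial (sqfree_exponent F) :: ('a, 'b) mpoly) \<in> ?L"
    unfolding monomial_in_sqfree_ideal_iff by auto
  ultimately show "p \<in> ?L" using is_ideal_sqfree_ideal[of "insert F S"] unfolding p is_ideal_def by blast
qed

lemma is_ideal_ideal_gen: "is_ideal (ideal_gen S)"
  unfolding is_ideal_def
proof (intro conjI ballI allI)
  show "0 \<in> ideal_gen S" unfolding ideal_gen_def by (intro CollectI exI[of _ "{}"]) auto
  fix a assume "a \<in> ideal_gen S"
  then obtain T r where a: "a = (\<Sum>s\<in>T. r s * s)" "finite T" "T \<subseteq> S" unfolding ideal_gen_def by auto
  show "a + b \<in> ideal_gen S" if b: "b \<in> ideal_gen S" for b
  proof -
    obtain U q where b: "b = (\<Sum>s\<in>U. q s * s)" "finite U" "U \<subseteq> S"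
      using b unfolding ideal_gen_def by auto
    have "a = (\<Sum>s\<in>T \<union> U. (if s \<in> T then r s else 0) * s)"
      unfolding a(1) by (rule sum.mono_neutral_cong_left) (use a b in auto)
    moreover have "b = (\<Sum>s\<in>T \<union> U. (if s \<in> U then q s else 0) * s)"
      unfolding b(1) by (rule sum.mono_neutral_cong_left) (use a b in auto)
    ultimately have "a + b = (\<Sum>s\<in>T \<union> U. ((if s \<in> T then r s else 0) + (if s \<in> U then q s else 0)) * s)"
      by (simp only: sum.distrib distrib_right)
    then show ?thesis unfolding ideal_gen_def
      by (intro CollectI exI[of _ "T \<union> U"] exI[of _ "\<lambda>s. (if s \<in> T then r s else 0) + (if s \<in> U then q s else 0)"])
        (use a b in blast)
  qed
  show "c * a \<in> ideal_gen S" for c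
    unfolding ideal_gen_def a(1)
    by (intro CollectI exI[of _ T] exI[of _ "\<lambda>s. c * r s"]) (use a in \<open>auto simp: sum_distrib_left mult.assoc\<close>)
qed

lemma ideal_gen_generator: "s \<in> S \<Longrightarrow> s \<in> ideal_gen S"
  unfolding ideal_gen_def by (intro CollectI exI[of _ "{s}"] exI[of _ "\<lambda>_. 1"]) auto

lemma facet_ideal_eq_sqfree_ideal:
  "(facet_ideal \<Delta> :: ('v::finite, 'k::field) mpoly set) = sqfree_ideal (facets \<Delta>)"
proof (intro equalityI subsetI)
  let ?gen = "(\<lambda>F. \<Prod>v\<in>F. Var v) ` facets \<Delta> :: ('v, 'k) mpoly set"
  fix p :: "('v, 'k) mpoly"
  show "p \<in> sqfree_ideal (facets \<Delta>)" if p: "p \<in> facet_ideal \<Delta>"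
  proof -
    obtain T r where p: "p = (\<Sum>s\<in>T. r s * s)" and T: "T \<subseteq> ?gen"
      using p unfolding facet_ideal_def ideal_gen_def by auto
    have "s \<in> sqfree_ideal (facets \<Delta>)" if "s \<in> ?gen" for s
      using that by (auto simp: prod_Var_eq_monomial monomial_in_sqfree_ideal_iff)
    then show ?thesis unfolding p using is_ideal_sqfree_ideal T
      by (intro is_ideal_sum) (auto simp: is_ideal_def)
  qed
  show "p \<in> facet_ideal \<Delta>" if p: "p \<in> sqfree_ideal (facets \<Delta>)"
    unfolding facet_ideal_def
  proof (rule in_ideal_if_monomials[OF is_ideal_ideal_gen])
    fix t assume "t \<in> Poly_Mapping.keys p"
    then obtain F where F: "F \<in> facets \<Delta>" "F \<subseteq> Poly_Mapping.keys t" 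
      using p unfolding sqfree_ideal_def by auto
    obtain u where "t = u + sqfree_exponent F" by (rule sqfree_exponent_divides[OF F(2)])
    then have t: "(monomial t :: ('v, 'k) mpoly) = monomial u * (\<Prod>v\<in>F. Var v)"
      unfolding prod_Var_eq_monomial by (simp add: mult_single)
    have "(\<Prod>v\<in>F. Var v) \<in> ideal_gen ?gen" using F by (intro ideal_gen_generator) simp
    then show "monomial t \<in> ideal_gen ?gen"
      unfolding t using is_ideal_ideal_gen[of ?gen] unfolding is_ideal_def by blast
  qed
qed

lemma lookup_monomial_mult_add:
  "Poly_Mapping.lookup (monomial u * p) (u + t) = Poly_Mapping.lookup (p :: ('v, 'k::field) mpoly) t"
  unfolding lookup_mult_sum by (auto simp: when_def in_keys_iff)

lemma keys_monomial_mult: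
  "Poly_Mapping.keys (monomial u * (p :: ('v, 'k::field) mpoly)) = (\<lambda>t. u + t) ` Poly_Mapping.keys p"
proof
  show "Poly_Mapping.keys (monomial u * p) \<subseteq> (\<lambda>t. u + t) ` Poly_Mapping.keys p"
    using keys_mult[of "monomial u" p] by auto
qed (auto simp: in_keys_iff lookup_monomial_mult_add)

lemma monomial_mult_in_sqfree_ideal_iff:
  "monomial u * (p :: ('v::finite, 'k::field) mpoly) \<in> sqfree_ideal S \<longleftrightarrow>
    (\<forall>t\<in>Poly_Mapping.keys p. \<exists>H\<in>S. H \<subseteq> Poly_Mapping.keys u \<union> Poly_Mapping.keys t)"
  unfolding sqfree_ideal_def by (simp add: keys_monomial_mult keys_add_nat)

text \<open>The Koszul complex: the variables form a regular sequence, so adding \<open>x\<^sub>v\<close> to the ideal \<open>I\<close> of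
  the earlier variables uses \<open>I : x\<^sub>v = I\<close>, and the ranks obey Pascal's rule.\<close>

lemma has_minimal_resolution_variables:
  fixes N :: "'v::finite set"
  shows "has_minimal_resolution (sqfree_ideal ((\<lambda>v. {v}) ` N) :: ('v, 'k::field) mpoly set) (\<lambda>i. card N choose i)"
proof -
  have "finite N" by simp
  then show ?thesis
  proof (induction N)
    case empty
    have "(sqfree_ideal ((\<lambda>v. {v}) ` {}) :: ('v, 'k) mpoly set) = {0}" unfolding sqfree_ideal_def by auto
    moreover have "(\<lambda>i. card {} choose i) = (\<lambda>i. if i = 0 then 1 else 0)" by (auto simp: fun_eq_iff)
    ultimately show ?case using has_minimal_resolution_zero by simp
  next
    case (insert v N)
    let ?x = "monomial (sqfree_exponent {v}) :: ('v, 'k) mpoly"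
    let ?I = "sqfree_ideal ((\<lambda>v. {v}) ` N) :: ('v, 'k) mpoly set"
    have colon: "{a. 1 * ?x * a \<in> ?I} = ?I"
      unfolding mult_1_left monomial_mult_in_sqfree_ideal_iff using insert(2)
      by (auto simp: sqfree_ideal_def)
    have "sqfree_exponent {v} \<noteq> 0" by (metis insert_not_empty keys_sqfree_exponent keys_zero)
    then have x: "Poly_Mapping.lookup ?x 0 = 0" by (simp add: lookup_single)
    have "has_minimal_resolution {a + r * (1 * ?x) | a r. a \<in> ?I}
        (\<lambda>i. (card N choose i) + (case i of 0 \<Rightarrow> 0 | Suc j \<Rightarrow> card N choose j))"
      by (rule has_minimal_resolution_add_generator[OF insert(3) _ is_ideal_sqfree_ideal x])
        (unfold colon, rule insert(3), use colon in auto)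
    moreover have "{a + r * (1 * ?x) | a r. a \<in> ?I} = sqfree_ideal ((\<lambda>v. {v}) ` insert v N)"
      unfolding mult_1_left image_insert sqfree_ideal_insert ..
    moreover have "(card N choose i) + (case i of 0 \<Rightarrow> 0 | Suc j \<Rightarrow> card N choose j) = card (insert v N) choose i" for i
      using insert(1,2) by (cases i) auto
    ultimately show ?case by simp
  qed
qed

text \<open>The new generator has support \<open>B \<union> {w}\<close>. By hypothesis the colon ideal is generated by the
  variables \<open>v\<close> for which \<open>B \<union> {v}\<close> is an old generator. Multiplying by the monomial of \<open>B\<close> already
  moves these variables into the old ideal, so the generator splits as required into the monomial
  of \<open>B\<close> and the variable \<open>w\<close>.\<close>

lemma has_minimal_resolution_linear_quotient:
  fixes S :: "'v::finite set set"
  assumes S: "has_minimal_resolution (sqfree_ideal S :: ('v, 'k::field) mpoly set) b"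
    and w: "w \<notin> B"
    and colon: "\<And>H. H \<in> S \<Longrightarrow> \<exists>v\<in>H - insert w B. insert v B \<in> S"
  shows "has_minimal_resolution (sqfree_ideal (insert (insert w B) S) :: ('v, 'k) mpoly set)
    (\<lambda>i. b i + (case i of 0 \<Rightarrow> 0 | Suc j \<Rightarrow> card {v. insert v B \<in> S} choose j))"
proof -
  let ?N = "{v. insert v B \<in> S}"
  let ?g = "monomial (sqfree_exponent B) :: ('v, 'k) mpoly"
  let ?x = "monomial (sqfree_exponent {w}) :: ('v, 'k) mpoly"
  let ?I = "sqfree_ideal S :: ('v, 'k) mpoly set"
  have gx: "?g * ?x = monomial (sqfree_exponent (insert w B))"
    using sqfree_exponent_Un_disjoint[of B "{w}"] w by (simp add: mult_single)
  have N: "v \<noteq> w" "v \<notin> B" if "v \<in> ?N" for v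
    using colon[of "insert v B"] that by auto
  have "(\<exists>H\<in>S. H \<subseteq> insert w B \<union> K) \<longleftrightarrow> (\<exists>v\<in>?N. v \<in> K)" for K
  proof
    assume "\<exists>H\<in>S. H \<subseteq> insert w B \<union> K"
    then obtain H where "H \<in> S" "H \<subseteq> insert w B \<union> K" by blast
    then show "\<exists>v\<in>?N. v \<in> K" using colon[of H] by blast
  next
    assume "\<exists>v\<in>?N. v \<in> K"
    then show "\<exists>H\<in>S. H \<subseteq> insert w B \<union> K" by blast
  qed
  then have colon': "{a. ?g * ?x * a \<in> ?I} = sqfree_ideal ((\<lambda>v. {v}) ` ?N)"
    unfolding gx monomial_mult_in_sqfree_ideal_iff keys_sqfree_exponent
    unfolding sqfree_ideal_def by simp
  have g: "?g * a \<in> ?I" if "?g * ?x * a \<in> ?I" for a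
  proof -
    have "a \<in> sqfree_ideal ((\<lambda>v. {v}) ` ?N)" using that colon' by blast
    then have "\<exists>v\<in>?N. v \<in> Poly_Mapping.keys t" if "t \<in> Poly_Mapping.keys a" for t
      using that unfolding sqfree_ideal_def by auto
    then show ?thesis
      unfolding monomial_mult_in_sqfree_ideal_iff keys_sqfree_exponent by blast
  qed
  have "sqfree_exponent {w} \<noteq> 0" by (metis insert_not_empty keys_sqfree_exponent keys_zero)
  then have x: "Poly_Mapping.lookup ?x 0 = 0" by (simp add: lookup_single)
  have "has_minimal_resolution {a + r * (?g * ?x) | a r. a \<in> ?I}
      (\<lambda>i. b i + (case i of 0 \<Rightarrow> 0 | Suc j \<Rightarrow> card ?N choose j))"
    by (rule has_minimal_resolution_add_generator[OF S _ is_ideal_sqfree_ideal x g])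
      (unfold colon', rule has_minimal_resolution_variables)
  then show ?thesis unfolding gx sqfree_ideal_insert .
qed

section \<open>Linear quotients along leaves\<close>

text \<open>Facets with \<open>D\<close> vertices are adjacent if they share a ridge, a face with \<open>D - 1\<close> vertices. The
  set \<open>U\<close> confines the walk: two facets are to be joined inside their union, which for the facet
  ideal means by linear relations among generators dividing their least common multiple.\<close>

definition ridge_step :: "nat \<Rightarrow> 'v set set \<Rightarrow> 'v set \<Rightarrow> ('v set \<times> 'v set) set" where
  "ridge_step D S U = {(A, B). A \<in> S \<and> B \<in> S \<and> A \<subseteq> U \<and> B \<subseteq> U \<and> Suc (card (A \<inter> B)) = D}"

definition linked :: "nat \<Rightarrow> 'v set set \<Rightarrow> bool" where
  "linked D S \<longleftrightarrow> (\<forall>F\<in>S. \<forall>H\<in>S. (F, H) \<in> (ridge_step D S (F \<union> H))\<^sup>*)"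

definition joint :: "'v set set \<Rightarrow> 'v set \<Rightarrow> 'v set \<Rightarrow> bool" where
  "joint S F G \<longleftrightarrow> G \<in> S \<and> G \<noteq> F \<and> (\<forall>H\<in>S. H \<noteq> F \<longrightarrow> F \<inter> H \<subseteq> F \<inter> G)"

context
  fixes S :: "'v::finite set set" and D :: nat and F G :: "'v set"
  assumes card: "\<And>A. A \<in> S \<Longrightarrow> card A = D" and linked: "linked D S"
    and F: "F \<in> S" and joint: "joint S F G"
begin

text \<open>The first step of a walk leaving the leaf \<open>F\<close> crosses a ridge contained in \<open>F \<inter> G\<close>. As
  \<open>F \<inter> G\<close> is a proper subset of \<open>F\<close>, it has to be that ridge. So every walk leaves \<open>F\<close> through the
  same ridge, and the vertex gained by the first step of a walk to \<open>H\<close> lies in \<open>H\<close>.\<close>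

lemma card_joint_ridge: "Suc (card (F \<inter> G)) = D"
  and linked_to_leaf_step:
    "\<And>H. H \<in> S - {F} \<Longrightarrow> \<exists>v\<in>H - F. insert v (F \<inter> G) \<in> S - {F}"
  and ridge_meets_leaf: "\<And>A U. (F, A) \<in> ridge_step D S U \<Longrightarrow> F \<inter> A = F \<inter> G"
proof -
  have G: "G \<in> S" "G \<noteq> F" using joint unfolding joint_def by auto
  have "F \<inter> G \<noteq> F"
    using G F card card_subset_eq[of G F] by (metis finite inf.absorb_iff1)
  then have less: "card (F \<inter> G) < D" using card[OF F] by (metis finite inf_le1 psubsetI psubset_card_mono)
  show meet: "F \<inter> A = F \<inter> G" if "(F, A) \<in> ridge_step D S U" for A U
  proof -
    have A: "A \<in> S" "Suc (card (F \<inter> A)) = D" using that unfolding ridge_step_def by auto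
    then have "A \<noteq> F" using card[OF F] by auto
    then have "F \<inter> A \<subseteq> F \<inter> G" using joint A unfolding joint_def by blast
    then show ?thesis using less A(2) card_seteq[of "F \<inter> G" "F \<inter> A"] by auto
  qed
  have first: "\<exists>A. (F, A) \<in> ridge_step D S (F \<union> H)" if "H \<in> S - {F}" for H
  proof -
    have "(F, H) \<in> (ridge_step D S (F \<union> H))\<^sup>*" using linked F that unfolding linked_def by blast
    then show ?thesis using that by (auto elim: converse_rtranclE)
  qed
  obtain A where A: "(F, A) \<in> ridge_step D S (F \<union> G)" using first[of G] G by blast
  then have "Suc (card (F \<inter> A)) = D" unfolding ridge_step_def by blast
  then show ridge: "Suc (card (F \<inter> G)) = D" unfolding meet[OF A] .
  show "\<exists>v\<in>H - F. insert v (F \<inter> G) \<in> S - {F}" if H: "H \<in> S - {F}" for H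
  proof -
    obtain A where A: "(F, A) \<in> ridge_step D S (F \<union> H)" using first[OF H] by blast
    have AS: "A \<in> S" "A \<subseteq> F \<union> H" using A unfolding ridge_step_def by auto
    have sub: "F \<inter> G \<subseteq> A" using meet[OF A] by blast
    have "card (A - (F \<inter> G)) = 1"
      using card_Diff_subset[of "F \<inter> G" A] sub card[OF AS(1)] ridge by auto
    then obtain v where v: "A - (F \<inter> G) = {v}" by (meson card_1_singletonE)
    then have Aeq: "A = insert v (F \<inter> G)" using sub by blast
    have "v \<notin> F" using v meet[OF A] by blast
    then have "v \<in> H - F" "A \<noteq> F" using v AS(2) by blast+
    moreover have "insert v (F \<inter> G) \<in> S - {F}"
      unfolding Aeq[symmetric] using AS(1) calculation by blast
    ultimately show ?thesis by blast
  qed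
qed

lemma linked_remove_leaf: "linked D (S - {F})"
  unfolding linked_def
proof (intro ballI)
  fix A H assume A: "A \<in> S - {F}" and H: "H \<in> S - {F}"
  define U where "U = A \<union> H"
  let ?r = "ridge_step D S U" and ?r' = "ridge_step D (S - {F}) U"
  have sym: "(Y, X) \<in> ?r" if "(X, Y) \<in> ?r" for X Y
    using that unfolding ridge_step_def by (auto simp: Int_commute)
  have detour: "(Z \<noteq> F \<longrightarrow> (A, Z) \<in> ?r'\<^sup>*) \<and> (Z = F \<longrightarrow> (\<exists>Y. Y \<noteq> F \<and> (A, Y) \<in> ?r'\<^sup>* \<and> (Y, F) \<in> ?r))"
    if "(A, Z) \<in> ?r\<^sup>*" for Z
    using that
  proof (induction rule: rtrancl_induct)
    case base
    then show ?case using A by auto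
  next
    case (step X Z)
    have notFF: "(F, F) \<notin> ?r" using card[OF F] unfolding ridge_step_def by auto
    show ?case
    proof (cases "X = F")
      case False
      then have AX: "(A, X) \<in> ?r'\<^sup>*" using step by blast
      show ?thesis
      proof (cases "Z = F")
        case True
        then show ?thesis using AX False step(2) by auto
      next
        case Z: False
        then have "(X, Z) \<in> ?r'" using step(2) False unfolding ridge_step_def by auto
        then show ?thesis using AX Z by (auto intro: rtrancl_into_rtrancl)
      qed
    next
      case True
      then obtain Y where Y: "Y \<noteq> F" "(A, Y) \<in> ?r'\<^sup>*" "(Y, F) \<in> ?r" using step by blast
      have FZ: "(F, Z) \<in> ?r" and ZF: "Z \<noteq> F" using step(2) True notFF by auto
      \<comment> \<open>Both neighbours of \<open>F\<close> contain the ridge \<open>F \<inter> G\<close>, so the detour through \<open>F\<close> can be cut short.\<close>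
      have "F \<inter> G \<subseteq> Y \<inter> Z" using ridge_meets_leaf[OF FZ] ridge_meets_leaf[OF sym[OF Y(3)]] by blast
      then have ge: "D \<le> Suc (card (Y \<inter> Z))" using card_joint_ridge card_mono[of "Y \<inter> Z" "F \<inter> G"] by simp
      have YZ: "Y \<in> S" "Z \<in> S" "Y \<subseteq> U" "Z \<subseteq> U" using Y(3) FZ unfolding ridge_step_def by auto
      have "(A, Z) \<in> ?r'\<^sup>*"
      proof (cases "Y = Z")
        case True
        then show ?thesis using Y by simp
      next
        case False
        then have "Y \<inter> Z \<noteq> Y"
          using YZ card card_subset_eq[of Z Y] by (metis finite inf.absorb_iff1)
        then have "card (Y \<inter> Z) < D" using card[OF YZ(1)] by (metis finite inf_le1 psubsetI psubset_card_mono)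
        then have "(Y, Z) \<in> ?r'" using ge YZ ZF Y(1) unfolding ridge_step_def by auto
        then show ?thesis using Y by (auto intro: rtrancl_into_rtrancl)
      qed
      then show ?thesis using ZF by blast
    qed
  qed
  have "(A, H) \<in> ?r\<^sup>*" using linked A H unfolding linked_def U_def by blast
  then show "(A, H) \<in> (ridge_step D (S - {F}) (A \<union> H))\<^sup>*" using detour H unfolding U_def by blast
qed

end

definition ridge_degree :: "'v set set \<Rightarrow> 'v set \<Rightarrow> nat" where
  "ridge_degree S G = card {F \<in> S. G \<subseteq> F}"

definition linear_tree_betti :: "nat \<Rightarrow> 'v::finite set set \<Rightarrow> nat \<Rightarrow> nat" where
  "linear_tree_betti D S i =
    (if i = 0 then 1 else if i = 1 then card S
     else (\<Sum>G | Suc (card G) = D. ridge_degree S G choose i))"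

text \<open>Adding a facet that meets the others only inside its ridge \<open>B\<close> raises the degree of \<open>B\<close> by one.
  Its other ridges lie in no earlier facet; they get degree 1 and contribute \<open>1 choose i = 0\<close>. What
  remains is Pascal's rule at \<open>B\<close>, whose old degree counts the vertices \<open>v\<close> with \<open>B \<union> {v}\<close> in \<open>S\<close>.\<close>

lemma linear_tree_betti_insert:
  fixes S :: "'v::finite set set"
  assumes card: "\<And>A. A \<in> S \<Longrightarrow> card A = D" and w: "w \<notin> B" and F: "insert w B \<notin> S" and B: "Suc (card B) = D"
    and meet: "\<And>H. H \<in> S \<Longrightarrow> insert w B \<inter> H \<subseteq> B"
  shows "linear_tree_betti D (insert (insert w B) S) i =
    linear_tree_betti D S i + (case i of 0 \<Rightarrow> 0 | Suc j \<Rightarrow> card {v. insert v B \<in> S} choose j)"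
proof (cases "i \<le> 1")
  case True
  then show ?thesis using F by (cases i) (auto simp: linear_tree_betti_def)
next
  case False
  then obtain j where i: "i = Suc j" "j \<noteq> 0" by (cases i) auto
  let ?F = "insert w B"
  have finS: "finite {A \<in> S. G \<subseteq> A}" for G by (rule finite_subset[of _ UNIV]) auto
  have outside: "v \<notin> B" if "insert v B \<in> S" for v
    using card[OF that] B by (metis insert_absorb n_not_Suc_n)
  have N: "card {v. insert v B \<in> S} = ridge_degree S B"
    unfolding ridge_degree_def
  proof (rule bij_betw_same_card[of "\<lambda>v. insert v B"])
    have "A \<in> (\<lambda>v. insert v B) ` {v. insert v B \<in> S}" if A: "A \<in> S" "B \<subseteq> A" for A
    proof -
      have "card (A - B) = 1" using card_Diff_subset[of B A] A(2) card[OF A(1)] B by auto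
      then obtain v where "A - B = {v}" by (meson card_1_singletonE)
      then have "A = insert v B" using A(2) by blast
      then show ?thesis using A(1) by blast
    qed
    moreover have "inj_on (\<lambda>v. insert v B) {v. insert v B \<in> S}"
      using outside by (auto simp: inj_on_def)
    ultimately show "bij_betw (\<lambda>v. insert v B) {v. insert v B \<in> S} {A \<in> S. B \<subseteq> A}"
      unfolding bij_betw_def by auto
  qed
  have at_B: "ridge_degree (insert ?F S) B = Suc (ridge_degree S B)"
  proof -
    have "{A \<in> insert ?F S. B \<subseteq> A} = insert ?F {A \<in> S. B \<subseteq> A}" by auto
    then show ?thesis unfolding ridge_degree_def using F finS by simp
  qed
  have elsewhere: "ridge_degree (insert ?F S) G choose i = ridge_degree S G choose i"
    if G: "Suc (card G) = D" "G \<noteq> B" for G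
  proof (cases "G \<subseteq> ?F")
    case True
    have "\<not> G \<subseteq> H" if "H \<in> S" for H
    proof
      assume "G \<subseteq> H"
      then have "G \<subseteq> B" using meet[OF that] True by blast
      then show False using G B card_subset_eq[of B G] by auto
    qed
    then have "{A \<in> S. G \<subseteq> A} = {}" "{A \<in> insert ?F S. G \<subseteq> A} = {?F}" using True by auto
    then have "ridge_degree S G = 0" "ridge_degree (insert ?F S) G = 1" unfolding ridge_degree_def by simp_all
    then show ?thesis using i by simp
  next
    case False
    then have "{A \<in> insert ?F S. G \<subseteq> A} = {A \<in> S. G \<subseteq> A}" by auto
    then show ?thesis unfolding ridge_degree_def by simp
  qed
  have BR: "B \<in> {G. Suc (card G) = D}" using B by simp
  have fin: "finite {G :: 'v set. Suc (card G) = D}" by (rule finite_subset[of _ UNIV]) auto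
  have "linear_tree_betti D (insert ?F S) i =
      (ridge_degree (insert ?F S) B choose i) + (\<Sum>G \<in> {G. Suc (card G) = D} - {B}. ridge_degree (insert ?F S) G choose i)"
    unfolding linear_tree_betti_def using i sum.remove[OF fin BR] by simp
  also have "(\<Sum>G \<in> {G. Suc (card G) = D} - {B}. ridge_degree (insert ?F S) G choose i)
      = (\<Sum>G \<in> {G. Suc (card G) = D} - {B}. ridge_degree S G choose i)"
    by (intro sum.cong refl elsewhere) auto
  also have "(ridge_degree (insert ?F S) B choose i) = (ridge_degree S B choose i) + (ridge_degree S B choose j)"
    unfolding at_B i(1) by simp
  finally show ?thesis
    unfolding linear_tree_betti_def using i sum.remove[OF fin BR, of "\<lambda>G. ridge_degree S G choose i"] N by simp
qed

text \<open>Induction on the number of facets: a leaf \<open>F\<close> is a linear quotient over the remaining facets,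
  with ridge \<open>B = F \<inter> G\<close>. If \<open>F\<close> is the only facet, any ridge of it serves as \<open>B\<close>.\<close>

lemma has_minimal_resolution_linked_forest:
  fixes S :: "'v::finite set set"
  assumes "\<And>A. A \<in> S \<Longrightarrow> card A = D" and "D > 0" and "linked D S"
    and "\<And>T. T \<subseteq> S \<Longrightarrow> T \<noteq> {} \<Longrightarrow> \<exists>F\<in>T. T = {F} \<or> (\<exists>G. joint T F G)"
  shows "has_minimal_resolution (sqfree_ideal S :: ('v, 'k::field) mpoly set) (linear_tree_betti D S)"
  using assms
proof (induction "card S" arbitrary: S)
  case 0
  have "finite S" by (rule finite_subset[of _ UNIV]) auto
  then have S: "S = {}" using 0 by simp
  have "(sqfree_ideal {} :: ('v, 'k) mpoly set) = {0}" unfolding sqfree_ideal_def by auto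
  moreover have "linear_tree_betti D ({} :: 'v set set) = (\<lambda>i. if i = 0 then 1 else 0)"
    by (auto simp: fun_eq_iff linear_tree_betti_def ridge_degree_def intro!: sum.neutral)
  ultimately show ?case unfolding S using has_minimal_resolution_zero by simp
next
  case (Suc n)
  have finS: "finite S" by (rule finite_subset[of _ UNIV]) auto
  have "S \<noteq> {}" using Suc(2) by auto
  then obtain F where F: "F \<in> S" "S = {F} \<or> (\<exists>G. joint S F G)" using Suc(6)[of S] by blast
  define T where "T = S - {F}"
  have S: "S = insert F T" "F \<notin> T" using F unfolding T_def by auto
  have "card T = n" using Suc(2) F finS unfolding T_def by simp
  have linkedT: "linked D T"
  proof (cases "S = {F}")
    case True
    then show ?thesis unfolding T_def linked_def by simp
  next
    case False
    then obtain G where "joint S F G" using F by blast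
    then show ?thesis unfolding T_def using linked_remove_leaf[OF Suc(3) Suc(5) F(1)] by blast
  qed
  have IH: "has_minimal_resolution (sqfree_ideal T :: ('v, 'k) mpoly set) (linear_tree_betti D T)"
  proof (rule Suc(1)[OF _ _ Suc(4) linkedT])
    show "n = card T" using \<open>card T = n\<close> ..
    show "card A = D" if "A \<in> T" for A using that Suc(3) unfolding T_def by simp
    show "\<exists>F\<in>U. U = {F} \<or> (\<exists>G. joint U F G)" if "U \<subseteq> T" "U \<noteq> {}" for U
      by (rule Suc(6)) (use that in \<open>auto simp: T_def\<close>)
  qed
  obtain w B where wB: "w \<notin> B" "F = insert w B" "Suc (card B) = D"
    and meet: "\<And>H. H \<in> T \<Longrightarrow> F \<inter> H \<subseteq> B"
    and colon: "\<And>H. H \<in> T \<Longrightarrow> \<exists>v\<in>H - F. insert v B \<in> T"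
  proof (cases "S = {F}")
    case True
    have "F \<noteq> {}" using Suc(3)[OF F(1)] Suc(4) by auto
    then obtain w where w: "w \<in> F" by blast
    have T: "T = {}" using True unfolding T_def by simp
    show ?thesis
    proof (rule that[of w "F - {w}"])
      show "Suc (card (F - {w})) = D" using w Suc(3)[OF F(1)] Suc(4) by simp
    qed (use w T in auto)
  next
    case False
    then obtain G where G: "joint S F G" using F by blast
    have ridge: "Suc (card (F \<inter> G)) = D" by (rule card_joint_ridge[OF Suc(3) Suc(5) F(1) G])
    have "card (F - (F \<inter> G)) = 1"
      using card_Diff_subset[of "F \<inter> G" F] Suc(3)[OF F(1)] ridge by auto
    then obtain w where "F - (F \<inter> G) = {w}" by (meson card_1_singletonE)
    then have w: "w \<notin> F \<inter> G" "F = insert w (F \<inter> G)" by blast+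
    show ?thesis
    proof (rule that[OF w ridge])
      show "F \<inter> H \<subseteq> F \<inter> G" if "H \<in> T" for H using that G unfolding joint_def T_def by blast
      show "\<exists>v\<in>H - F. insert v (F \<inter> G) \<in> T" if "H \<in> T" for H
        using linked_to_leaf_step[OF Suc(3) Suc(5) F(1) G] that unfolding T_def by blast
    qed
  qed
  have "has_minimal_resolution (sqfree_ideal (insert (insert w B) T) :: ('v, 'k) mpoly set)
    (\<lambda>i. linear_tree_betti D T i + (case i of 0 \<Rightarrow> 0 | Suc j \<Rightarrow> card {v. insert v B \<in> T} choose j))"
    by (rule has_minimal_resolution_linear_quotient[OF IH wB(1)]) (use colon wB(2) in blast)
  moreover have "linear_tree_betti D (insert (insert w B) T) = (\<lambda>i. linear_tree_betti D T i
      + (case i of 0 \<Rightarrow> 0 | Suc j \<Rightarrow> card {v. insert v B \<in> T} choose j))"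
  proof (rule ext, rule linear_tree_betti_insert[OF _ wB(1) _ wB(3)])
    show "card A = D" if "A \<in> T" for A using that Suc(3) unfolding T_def by simp
    show "insert w B \<notin> T" using S(2) unfolding wB(2) .
    show "insert w B \<inter> H \<subseteq> B" if "H \<in> T" for H using meet[OF that] unfolding wB(2) .
  qed
  ultimately show ?case unfolding S(1) wB(2) by (simp only:)
qed

section \<open>Linear resolutions connect the generators\<close>

definition total_degree :: "('v::finite \<Rightarrow>\<^sub>0 nat) \<Rightarrow> nat" where
  "total_degree t = (\<Sum>v\<in>UNIV. Poly_Mapping.lookup t v)"

lemma homogeneous_iff:
  "homogeneous k (p :: ('v::finite, 'k::field) mpoly) \<longleftrightarrow> (\<forall>t\<in>Poly_Mapping.keys p. total_degree t = k)"
proof -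
  have "(\<Sum>v\<in>Poly_Mapping.keys t. Poly_Mapping.lookup t v) = total_degree t" for t :: "'v \<Rightarrow>\<^sub>0 nat"
    unfolding total_degree_def by (rule sum.mono_neutral_left) (auto simp: in_keys_iff)
  then show ?thesis unfolding homogeneous_def by simp
qed

lemma total_degree_add: "total_degree (s + t) = total_degree s + total_degree t"
  unfolding total_degree_def by (simp add: lookup_add sum.distrib)

lemma total_degree_sqfree_exponent [simp]: "total_degree (sqfree_exponent F) = card F"
  unfolding total_degree_def by (simp add: lookup_sqfree_exponent sum.If_cases)

lemma total_degree_eq_0: "total_degree t = 0 \<Longrightarrow> t = 0"
  unfolding total_degree_def by (intro poly_mapping_eqI) simp

lemma keys_multE:
  assumes "t \<in> Poly_Mapping.keys (p * q)"
  obtains s u where "s \<in> Poly_Mapping.keys p" "u \<in> Poly_Mapping.keys q" "t = s + u"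
  using assms keys_mult[of p q] by blast

lemma sqfree_exponent_factor:
  assumes "sqfree_exponent T = s + u"
  obtains A where "s = sqfree_exponent A" "A \<subseteq> T"
proof
  have le: "Poly_Mapping.lookup s v \<le> (if v \<in> T then 1 else 0)" for v
    using arg_cong[OF assms, of "\<lambda>t. Poly_Mapping.lookup t v"] by (simp add: lookup_sqfree_exponent lookup_add split: if_splits)
  show "s = sqfree_exponent (Poly_Mapping.keys s)"
  proof (rule poly_mapping_eqI)
    fix v show "Poly_Mapping.lookup s v = Poly_Mapping.lookup (sqfree_exponent (Poly_Mapping.keys s)) v"
      using le[of v] by (auto simp: lookup_sqfree_exponent in_keys_iff split: if_splits)
  qed
  show "Poly_Mapping.keys s \<subseteq> T"
    using arg_cong[OF assms, of Poly_Mapping.keys] by (simp add: keys_add_nat)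
qed

lemma homogeneous_generator_is_monomial:
  fixes S :: "'v::finite set set" and p :: "('v, 'k::field) mpoly"
  assumes card: "\<And>A. A \<in> S \<Longrightarrow> card A = D"
    and p: "p \<in> sqfree_ideal S" "homogeneous D p" and t: "t \<in> Poly_Mapping.keys p"
  obtains A where "A \<in> S" "t = sqfree_exponent A"
proof -
  obtain A where A: "A \<in> S" "A \<subseteq> Poly_Mapping.keys t" using p t unfolding sqfree_ideal_def by blast
  obtain u where u: "t = u + sqfree_exponent A" by (rule sqfree_exponent_divides[OF A(2)])
  have "total_degree t = D" using p(2) t unfolding homogeneous_iff by blast
  then have "total_degree u = 0" unfolding u total_degree_add using card[OF A(1)] by simp
  then have "t = sqfree_exponent A" unfolding u by (simp add: total_degree_eq_0)
  then show ?thesis using that A by blast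
qed

lemma expand_in_sqfree_monomials:
  fixes S :: "'v::finite set set" and p :: "('v, 'k::field) mpoly"
  assumes "\<And>t. t \<in> Poly_Mapping.keys p \<Longrightarrow> \<exists>A\<in>S. t = sqfree_exponent A"
  shows "p = (\<Sum>A\<in>S. Poly_Mapping.single (sqfree_exponent A) (Poly_Mapping.lookup p (sqfree_exponent A)))"
proof (rule poly_mapping_eqI)
  fix t
  have fin: "finite S" by (rule finite_subset[of _ UNIV]) auto
  show "Poly_Mapping.lookup p t = Poly_Mapping.lookup (\<Sum>A\<in>S. Poly_Mapping.single (sqfree_exponent A) (Poly_Mapping.lookup p (sqfree_exponent A))) t"
  proof (cases "\<exists>A\<in>S. t = sqfree_exponent A")
    case True
    then obtain A where A: "A \<in> S" "t = sqfree_exponent A" by blast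
    then show ?thesis using fin by (simp add: lookup_sum lookup_single when_def)
  next
    case False
    then have "Poly_Mapping.lookup p t = 0" using assms by (auto simp: in_keys_iff)
    moreover have "(\<Sum>A\<in>S. Poly_Mapping.lookup (Poly_Mapping.single (sqfree_exponent A) (Poly_Mapping.lookup p (sqfree_exponent A))) t) = 0"
      using False by (intro sum.neutral) (auto simp: lookup_single when_def)
    ultimately show ?thesis by (simp add: lookup_sum)
  qed
qed

lemma free_resolution_generator_mem:
  assumes res: "free_resolution d e J {0}" and j: "j < dim_col (d 0)"
  shows "e $ j \<in> J"
proof -
  have "{e \<bullet> v + a | v a. v \<in> carrier_vec (dim_col (d 0)) \<and> a \<in> {0}} = J"
    using res unfolding free_resolution_def by blast
  moreover have "e $ j = e \<bullet> unit_vec (dim_col (d 0)) j + 0"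
    using free_resolution_carrier(3)[OF res] j by simp
  ultimately show ?thesis using unit_vec_carrier by blast
qed

text \<open>The monomial of a facet is a minimal generator, so one of the generators \<open>e\<close>, all of degree \<open>D\<close>,
  must contain it as a term.\<close>

lemma linear_resolution_generator_degree:
  fixes S :: "'v::finite set set" and e :: "('v, 'k::field) mpoly vec"
  assumes res: "free_resolution d e (sqfree_ideal S) {0}"
    and hom: "\<And>j. j < dim_vec e \<Longrightarrow> homogeneous D (e $ j)"
    and antichain: "\<And>A B. A \<in> S \<Longrightarrow> B \<in> S \<Longrightarrow> A \<subseteq> B \<Longrightarrow> A = B" and F: "F \<in> S"
  shows "card F = D"
proof -
  note ec = free_resolution_carrier(3)[OF res]
  have eI: "e $ j \<in> sqfree_ideal S" if "j < dim_vec e" for j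
    using free_resolution_generator_mem[OF res] that ec by simp
  have "(monomial (sqfree_exponent F) :: ('v, 'k) mpoly) \<in> sqfree_ideal S"
    using F by (auto simp: monomial_in_sqfree_ideal_iff)
  then obtain c b where c: "c \<in> carrier_vec (dim_col (d 0))" "b \<in> {0}" "monomial (sqfree_exponent F) = e \<bullet> c + b"
    by (rule free_resolution_generates[OF res])
  have "Poly_Mapping.lookup (e \<bullet> c) (sqfree_exponent F) \<noteq> 0"
    using c(2) arg_cong[OF c(3), of "\<lambda>p. Poly_Mapping.lookup p (sqfree_exponent F)"] by simp
  then have "(\<Sum>j<dim_vec e. Poly_Mapping.lookup (e $ j * c $ j) (sqfree_exponent F)) \<noteq> 0"
    using ec c(1) by (simp add: scalar_prod_def lookup_sum atLeast0LessThan)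
  then obtain j where j: "j < dim_vec e" "Poly_Mapping.lookup (e $ j * c $ j) (sqfree_exponent F) \<noteq> 0"
    by (rule sum.not_neutral_contains_not_neutral) simp
  then have "sqfree_exponent F \<in> Poly_Mapping.keys (e $ j * c $ j)" by (simp add: in_keys_iff)
  then obtain s u where su: "s \<in> Poly_Mapping.keys (e $ j)" "sqfree_exponent F = s + u"
    by (rule keys_multE)
  obtain A where A: "s = sqfree_exponent A" "A \<subseteq> F" by (rule sqfree_exponent_factor[OF su(2)])
  obtain H where H: "H \<in> S" "H \<subseteq> Poly_Mapping.keys s" using eI[OF j(1)] su(1) unfolding sqfree_ideal_def by blast
  then have "H \<subseteq> A" unfolding A(1) by simp
  then have "A = F" using antichain[OF H(1) F] A(2) by blast
  moreover have "total_degree s = D" using hom[OF j(1)] su(1) unfolding homogeneous_iff by blast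
  ultimately show ?thesis unfolding A(1) by simp
qed

lemma lookup_single_mult_sqfree:
  fixes p :: "('v::finite, 'k::field) mpoly"
  assumes "Poly_Mapping.lookup (Poly_Mapping.single (sqfree_exponent A) a * p) (sqfree_exponent T) \<noteq> 0"
  obtains u where "sqfree_exponent T = sqfree_exponent A + u" "u \<in> Poly_Mapping.keys p" "A \<subseteq> T"
proof -
  have "sqfree_exponent T \<in> Poly_Mapping.keys (Poly_Mapping.single (sqfree_exponent A) a * p)"
    using assms by (simp add: in_keys_iff)
  then obtain s u where su: "s \<in> Poly_Mapping.keys (Poly_Mapping.single (sqfree_exponent A) a)" 
    "u \<in> Poly_Mapping.keys p" "sqfree_exponent T = s + u"
    by (rule keys_multE)
  then have s: "s = sqfree_exponent A" by (simp split: if_splits)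
  moreover have "A \<subseteq> T"
    using arg_cong[OF su(3), of Poly_Mapping.keys] unfolding s by (auto simp: keys_add_nat)
  ultimately show ?thesis using that su by metis
qed

text \<open>Suppose that \<open>F\<close> and \<open>H\<close> lie in different components of the facets inside \<open>F \<union> H\<close>, and let \<open>C\<close>
  be the component of \<open>F\<close>. The relation \<open>x\<^bsup>H-F\<^esup> x\<^bsup>F\<^esup> = x\<^bsup>F-H\<^esup> x\<^bsup>H\<^esup>\<close> is a combination of the
  linear relations in \<open>d 1\<close>. Dropping from a relation the terms of all generators outside \<open>C\<close> and
  taking the coefficient of \<open>x\<^bsup>F\<union>H\<^esup>\<close> kills these combinations: a squarefree monomial \<open>x\<^bsup>M\<^esup>\<close> with
  \<open>M \<subseteq> F \<union> H\<close> can occur in a linear relation only if \<open>M\<close> has \<open>D + 1\<close> vertices, and then the facets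
  inside \<open>M\<close> are pairwise adjacent and lie all in \<open>C\<close> or all outside. On the given relation
  the same operation yields \<open>1\<close>.\<close>

lemma linear_resolution_linked:
  fixes S :: "'v::finite set set" and e :: "('v, 'k::field) mpoly vec"
  assumes res: "free_resolution d e (sqfree_ideal S) {0}"
    and hom: "\<And>j. j < dim_vec e \<Longrightarrow> homogeneous D (e $ j)"
    and lin: "\<And>r c. r < dim_row (d 1) \<Longrightarrow> c < dim_col (d 1) \<Longrightarrow> homogeneous 1 (d 1 $$ (r, c))"
    and card: "\<And>A. A \<in> S \<Longrightarrow> card A = D"
  shows "linked D S"
  unfolding linked_def
proof (intro ballI)
  fix F H assume F: "F \<in> S" and H: "H \<in> S"
  let ?r = "ridge_step D S (F \<union> H)"
  define n where "n = dim_col (d 0)"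
  define m where "m = dim_col (d 1)"
  note ec = free_resolution_carrier(3)[OF res, folded n_def]
  have dc: "d 1 \<in> carrier_mat n m"
    unfolding n_def m_def One_nat_def by (rule free_resolution_carrier(2)[OF res])
  have finS: "finite S" by (rule finite_subset[of _ UNIV]) auto
  define C where "C = {A \<in> S. (F, A) \<in> ?r\<^sup>*}"
  have CS: "C \<subseteq> S" unfolding C_def by blast
  have eI: "e $ j \<in> sqfree_ideal S" if "j < n" for j
    using free_resolution_generator_mem[OF res] that unfolding n_def by simp
  \<comment> \<open>The entries of \<open>e\<close> are combinations of the facet monomials; \<open>part B v\<close> is \<open>e \<bullet> v\<close> with all
    facet monomials outside \<open>B\<close> deleted from \<open>e\<close>.\<close>
  define coef where "coef A j = Poly_Mapping.lookup (e $ j) (sqfree_exponent A)" for A j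
  define part where "part B v = (\<Sum>A\<in>B. \<Sum>j<n. Poly_Mapping.single (sqfree_exponent A) (coef A j) * v $ j)"
    for B and v :: "('v, 'k) mpoly vec"
  have part_S: "part S v = e \<bullet> v" if v: "v \<in> carrier_vec n" for v
  proof -
    have "e $ j = (\<Sum>A\<in>S. Poly_Mapping.single (sqfree_exponent A) (coef A j))" if j: "j < n" for j
      unfolding coef_def
    proof (rule expand_in_sqfree_monomials)
      fix t assume t: "t \<in> Poly_Mapping.keys (e $ j)"
      have "homogeneous D (e $ j)" using hom ec j by simp
      then obtain A where "A \<in> S" "t = sqfree_exponent A"
        using homogeneous_generator_is_monomial[OF card eI[OF j] _ t] by blast
      then show "\<exists>A\<in>S. t = sqfree_exponent A" by blast
    qed
    then have "e \<bullet> v = (\<Sum>j<n. (\<Sum>A\<in>S. Poly_Mapping.single (sqfree_exponent A) (coef A j)) * v $ j)"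
      using v by (simp add: scalar_prod_def atLeast0LessThan)
    also have "\<dots> = (\<Sum>j<n. \<Sum>A\<in>S. Poly_Mapping.single (sqfree_exponent A) (coef A j) * v $ j)"
      by (simp add: sum_distrib_right)
    also have "\<dots> = part S v" unfolding part_def by (rule sum.swap)
    finally show ?thesis by simp
  qed
  have lookup_part: "Poly_Mapping.lookup (part B v) t =
      (\<Sum>A\<in>B. \<Sum>j<n. Poly_Mapping.lookup (Poly_Mapping.single (sqfree_exponent A) (coef A j) * v $ j) t)" for B v t
    unfolding part_def by (simp add: lookup_sum)
  have lookup_part_subset: "Poly_Mapping.lookup (part B v) t = Poly_Mapping.lookup (part B' v) t"
    if "B \<subseteq> B'" "B' \<subseteq> S" and zero: "\<And>A j. A \<in> B' - B \<Longrightarrow> j < n \<Longrightarrow>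
      Poly_Mapping.lookup (Poly_Mapping.single (sqfree_exponent A) (coef A j) * v $ j) t = 0" for B B' v t
    unfolding lookup_part
    by (rule sum.mono_neutral_left) (use that finS in \<open>auto intro: finite_subset sum.neutral\<close>)
  have column: "Poly_Mapping.lookup (part C (col (d 1) c)) (sqfree_exponent M) = 0"
    if c: "c < m" and M: "M \<subseteq> F \<union> H" for c M
  proof -
    let ?v = "col (d 1) c"
    have v: "?v \<in> carrier_vec n" using dc by auto
    have nonzero: "A \<subseteq> M \<and> card M = Suc D"
      if AS: "A \<in> S" and j: "j < n" and nz: "Poly_Mapping.lookup (Poly_Mapping.single (sqfree_exponent A) (coef A j) * ?v $ j) (sqfree_exponent M) \<noteq> 0" for A j
    proof -
      obtain u where u: "sqfree_exponent M = sqfree_exponent A + u" "u \<in> Poly_Mapping.keys (?v $ j)" "A \<subseteq> M"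
        by (rule lookup_single_mult_sqfree[OF nz])
      have "homogeneous 1 (?v $ j)" using lin[of j c] dc c j by simp
      then have "total_degree u = 1" using u(2) unfolding homogeneous_iff by blast
      then have "card M = card A + 1"
        using arg_cong[OF u(1), of total_degree] by (simp add: total_degree_add)
      then show ?thesis using u(3) card[OF AS] by simp
    qed
    show ?thesis
    proof (cases "\<exists>A\<in>C. A \<subseteq> M \<and> card M = Suc D")
      case True
      then obtain A where A: "A \<in> C" "A \<subseteq> M" "card M = Suc D" by blast
      have "B \<in> C" if B: "B \<in> S" "B \<subseteq> M" for B
      proof (cases "B = A")
        case False
        have cA: "card A = D" and cB: "card B = D" using A CS B card by auto
        have "A \<union> B \<subseteq> M" using A B by blast
        then have "card (A \<union> B) \<le> Suc D" using card_mono[of M "A \<union> B"] A(3) by simp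
        moreover have "card (A \<union> B) + card (A \<inter> B) = D + D" using card_Un_Int[of A B] cA cB by simp
        moreover have "card (A \<inter> B) < D"
        proof -
          have "A \<inter> B \<noteq> A" using False cA cB card_subset_eq[of B A] by (metis finite inf.absorb_iff1)
          then show ?thesis using cA by (metis finite inf_le1 psubsetI psubset_card_mono)
        qed
        ultimately have "Suc (card (A \<inter> B)) = D" by simp
        then have "(A, B) \<in> ?r" using A B M CS unfolding ridge_step_def by auto
        then show ?thesis using A(1) B(1) unfolding C_def by (auto intro: rtrancl_into_rtrancl)
      qed (use A in simp)
      then have "Poly_Mapping.lookup (part C ?v) (sqfree_exponent M) = Poly_Mapping.lookup (part S ?v) (sqfree_exponent M)"
        by (intro lookup_part_subset CS) (use nonzero in blast)+
      also have "part S ?v = e \<bullet> ?v" by (rule part_S[OF v])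
      also have "e \<bullet> ?v = e \<bullet> (d 1 *\<^sub>v unit_vec m c)"
        by (rule arg_cong[of _ _ "(\<bullet>) e"], rule eq_vecI) (use dc c in auto)
      also have "\<dots> = 0"
        using free_resolution_augment_comp[OF res, of "unit_vec m c"] unfolding m_def by simp
      finally show ?thesis by simp
    next
      case False
      then have "Poly_Mapping.lookup (Poly_Mapping.single (sqfree_exponent A) (coef A j) * ?v $ j) (sqfree_exponent M) = 0"
        if "A \<in> C" "j < n" for A j
        using nonzero[of A j] that CS by blast
      then show ?thesis unfolding lookup_part by simp
    qed
  qed
  define T where "T = F \<union> H"
  have range: "Poly_Mapping.lookup (part C (d 1 *\<^sub>v w)) (sqfree_exponent T) = 0" if w: "w \<in> carrier_vec m" for w
  proof -
    have "(d 1 *\<^sub>v w) $ j = (\<Sum>c<m. col (d 1) c $ j * w $ c)" if "j < n" for j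
      using that dc w by (simp add: scalar_prod_def atLeast0LessThan)
    then have "part C (d 1 *\<^sub>v w) = (\<Sum>A\<in>C. \<Sum>j<n. \<Sum>c<m. Poly_Mapping.single (sqfree_exponent A) (coef A j) * col (d 1) c $ j * w $ c)"
      unfolding part_def by (simp add: sum_distrib_left mult.assoc)
    also have "\<dots> = (\<Sum>A\<in>C. \<Sum>c<m. \<Sum>j<n. Poly_Mapping.single (sqfree_exponent A) (coef A j) * col (d 1) c $ j * w $ c)"
      by (intro sum.cong refl sum.swap)
    also have "\<dots> = (\<Sum>c<m. \<Sum>A\<in>C. \<Sum>j<n. Poly_Mapping.single (sqfree_exponent A) (coef A j) * col (d 1) c $ j * w $ c)"
      by (rule sum.swap)
    also have "\<dots> = (\<Sum>c<m. part C (col (d 1) c) * w $ c)"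
      unfolding part_def by (simp only: sum_distrib_right)
    finally have eq: "part C (d 1 *\<^sub>v w) = (\<Sum>c<m. part C (col (d 1) c) * w $ c)" .
    have "Poly_Mapping.lookup (part C (col (d 1) c) * w $ c) (sqfree_exponent T) = 0" if c: "c < m" for c
    proof (rule ccontr)
      assume "Poly_Mapping.lookup (part C (col (d 1) c) * w $ c) (sqfree_exponent T) \<noteq> 0"
      then have "sqfree_exponent T \<in> Poly_Mapping.keys (part C (col (d 1) c) * w $ c)" by (simp add: in_keys_iff)
      then obtain s u where su: "s \<in> Poly_Mapping.keys (part C (col (d 1) c))" "sqfree_exponent T = s + u"
        by (rule keys_multE)
      obtain M where M: "s = sqfree_exponent M" "M \<subseteq> T" by (rule sqfree_exponent_factor[OF su(2)])
      then show False using column[OF c, of M] su(1) unfolding T_def by (simp add: in_keys_iff)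
    qed
    then show ?thesis unfolding eq lookup_sum by simp
  qed
  have gen: "\<exists>c\<in>carrier_vec n. e \<bullet> c = monomial (sqfree_exponent A)" if A: "A \<in> S" for A
  proof -
    have "(monomial (sqfree_exponent A) :: ('v, 'k) mpoly) \<in> sqfree_ideal S"
      using A by (auto simp: monomial_in_sqfree_ideal_iff)
    then obtain c b where "c \<in> carrier_vec (dim_col (d 0))" "b \<in> {0}" "monomial (sqfree_exponent A) = e \<bullet> c + b"
      by (rule free_resolution_generates[OF res])
    then show ?thesis unfolding n_def by force
  qed
  have own: "Poly_Mapping.lookup (Poly_Mapping.single (sqfree_exponent A) (coef A j) * v $ j) (sqfree_exponent B) = 0"
    if "A \<in> S" "B \<in> S" "A \<noteq> B" for A B j v
  proof (rule ccontr)
    assume "Poly_Mapping.lookup (Poly_Mapping.single (sqfree_exponent A) (coef A j) * v $ j) (sqfree_exponent B) \<noteq> 0"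
    then obtain u where "A \<subseteq> B" by (rule lookup_single_mult_sqfree)
    then show False using that card card_subset_eq[of B A] by auto
  qed
  obtain a b where a: "a \<in> carrier_vec n" "e \<bullet> a = monomial (sqfree_exponent F)"
    and b: "b \<in> carrier_vec n" "e \<bullet> b = monomial (sqfree_exponent H)"
    using gen F H by metis
  define xF where "xF = (monomial (sqfree_exponent (H - F)) :: ('v, 'k) mpoly)"
  define xH where "xH = (monomial (sqfree_exponent (F - H)) :: ('v, 'k) mpoly)"
  have TF: "sqfree_exponent T = sqfree_exponent (H - F) + sqfree_exponent F"
    using sqfree_exponent_Un_disjoint[of "H - F" F] unfolding T_def by (simp add: Un_commute Diff_disjoint Int_commute)
  have TH: "sqfree_exponent T = sqfree_exponent (F - H) + sqfree_exponent H"
    using sqfree_exponent_Un_disjoint[of "F - H" H] unfolding T_def by (simp add: Diff_disjoint Int_commute)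
  define u where "u = xF \<cdot>\<^sub>v a - xH \<cdot>\<^sub>v b"
  have u: "u \<in> carrier_vec n" unfolding u_def using a b by auto
  have "e \<bullet> u = xF * (e \<bullet> a) - xH * (e \<bullet> b)"
    unfolding u_def using scalar_prod_minus_distrib[OF ec] a(1) b(1) ec by simp
  also have "\<dots> = 0" unfolding a(2) b(2) xF_def xH_def mult_single TF[symmetric] TH[symmetric] by simp
  finally have "u \<in> mat_range (d 1)"
    using free_resolution_augment[OF res] u unfolding n_def by simp
  then obtain w where w: "w \<in> carrier_vec m" "u = d 1 *\<^sub>v w" by (rule mat_rangeE[OF _ dc])
  have "part C u = xF * part C a - xH * part C b"
    unfolding part_def u_def using a(1) b(1)
    by (simp add: sum_distrib_left sum_subtractf algebra_simps)
  then have "Poly_Mapping.lookup (xF * part C a) (sqfree_exponent T) = Poly_Mapping.lookup (xH * part C b) (sqfree_exponent T)"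
    using range[OF w(1)] unfolding w(2)[symmetric] by (simp add: lookup_minus)
  then have eq: "Poly_Mapping.lookup (part C a) (sqfree_exponent F) = Poly_Mapping.lookup (part C b) (sqfree_exponent H)"
    unfolding xF_def xH_def by (subst (asm) TF, subst (asm) TH) (simp only: lookup_monomial_mult_add)
  have FC: "F \<in> C" unfolding C_def using F by simp
  have "Poly_Mapping.lookup (part C a) (sqfree_exponent F) = Poly_Mapping.lookup (part S a) (sqfree_exponent F)"
    by (rule lookup_part_subset[OF CS order_refl]) (use own F FC in blast)
  also have "\<dots> = 1" unfolding part_S[OF a(1)] a(2) by simp
  finally have one: "Poly_Mapping.lookup (part C b) (sqfree_exponent H) = 1" using eq by simp
  have "H \<in> C"
  proof (rule ccontr)
    assume "H \<notin> C"
    then have "Poly_Mapping.lookup (part C b) (sqfree_exponent H) = 0"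
      unfolding lookup_part using own CS H by (intro sum.neutral ballI) blast
    then show False using one by simp
  qed
  then show "(F, H) \<in> ?r\<^sup>*" unfolding C_def by blast
qed

section \<open>Betti numbers of linear trees\<close>

text \<open>A set of facets of a tree is the facet set of the subcomplex that it generates, so the tree
  condition provides a leaf in it.\<close>

lemma tree_facets_have_joint:
  assumes tree: "tree V \<Delta>" and S: "S \<subseteq> facets \<Delta>" "S \<noteq> {}"
  shows "\<exists>F\<in>S. S = {F} \<or> (\<exists>G. joint S F G)"
proof -
  define \<Gamma> where "\<Gamma> = {A. \<exists>F\<in>S. A \<subseteq> F}"
  have complex: "simplicial_complex V \<Delta>" using tree unfolding tree_def by blast
  have \<Gamma>: "A \<in> \<Gamma> \<longleftrightarrow> (\<exists>F\<in>S. A \<subseteq> F)" for A unfolding \<Gamma>_def by simp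
  have maximal: "F = A" if F: "F \<in> S" "A \<in> \<Gamma>" "F \<subseteq> A" for F A
  proof -
    obtain F' where F': "F' \<in> S" "A \<subseteq> F'" using F(2) \<Gamma> by blast
    then have "F' \<in> \<Delta>" "F \<subseteq> F'" using S(1) F(3) unfolding facets_def by blast+
    moreover have "F \<in> facets \<Delta>" using F(1) S(1) by blast
    ultimately have "F = F'" unfolding facets_def by simp
    then show ?thesis using F'(2) F(3) by simp
  qed
  have facets: "facets \<Gamma> = S"
  proof (intro equalityI subsetI)
    fix A assume A: "A \<in> facets \<Gamma>"
    then obtain F where F: "F \<in> S" "A \<subseteq> F" using \<Gamma> unfolding facets_def by auto
    then have "F \<in> \<Gamma>" using \<Gamma> by auto
    then show "A \<in> S" using A F unfolding facets_def by auto
  next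
    fix F assume F: "F \<in> S"
    then have "F \<in> \<Gamma>" using \<Gamma> by auto
    then show "F \<in> facets \<Gamma>" using maximal[OF F] unfolding facets_def by simp
  qed
  have "\<Union>S \<subseteq> V" using S(1) complex unfolding facets_def simplicial_complex_def by auto
  moreover have "finite V" using complex unfolding simplicial_complex_def by simp
  ultimately have "finite (\<Union>S)" by (rule finite_subset)
  then have "simplicial_complex (\<Union>S) \<Gamma>"
    unfolding simplicial_complex_def by (simp add: \<Gamma>) (auto simp: \<Gamma>_def)
  then have "subcomplex \<Gamma> \<Delta>" unfolding subcomplex_def facets using S(1) by blast
  moreover have "\<Gamma> \<noteq> {}" using S(2) unfolding \<Gamma>_def by blast
  ultimately obtain F where "leaf \<Gamma> F" using tree unfolding tree_def by blast
  then show ?thesis unfolding leaf_def joint_def facets by blast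
qed


theorem corollary3p10:
  fixes \<Delta> :: "'v::finite set set"
    and I :: "('v, 'k::field) mpoly set"
    and d :: int and m i :: nat
  assumes "linear_tree TYPE('k) \<Delta>"
    and "complex_dim \<Delta> = d"
    and "card (facets \<Delta>) = m"
    and "I = facet_ideal \<Delta>"
    and "i \<ge> 1"
  shows "betti UNIV I i =
           (if i = 1 then m
            else (\<Sum>G | G \<in> \<Delta> \<and> face_dim G = d - 1. card {F \<in> facets \<Delta>. G \<subseteq> F} choose i))"
proof -
  let ?S = "facets \<Delta>"
  have tree: "tree UNIV \<Delta>" and lin: "has_linear_resolution (facet_ideal \<Delta> :: ('v, 'k) mpoly set)"
    using assms(1) unfolding linear_tree_def by blast+
  have complex: "simplicial_complex UNIV \<Delta>" using tree unfolding tree_def by blast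
  obtain D r and e :: "('v, 'k) mpoly vec" where res: "free_resolution r e (sqfree_ideal ?S) {0}"
    and gens: "\<And>j. j < dim_vec e \<Longrightarrow> homogeneous D (e $ j)"
    and entries: "\<And>i a b. i \<ge> 1 \<Longrightarrow> a < dim_row (r i) \<Longrightarrow> b < dim_col (r i) \<Longrightarrow> homogeneous 1 (r i $$ (a, b))"
    using lin unfolding has_linear_resolution_def facet_ideal_eq_sqfree_ideal by blast
  have antichain: "A = B" if "A \<in> ?S" "B \<in> ?S" "A \<subseteq> B" for A B
    using that unfolding facets_def by blast
  have card: "card F = D" if "F \<in> ?S" for F
    by (rule linear_resolution_generator_degree[OF res gens antichain that])
  have linked: "linked D ?S"
    by (rule linear_resolution_linked[OF res gens entries card]) simp_all
  obtain F where F: "F \<in> ?S" "F \<noteq> {}"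
  proof -
    have "finite \<Delta>" by (rule finite_subset[of _ UNIV]) auto
    moreover have v: "{undefined} \<in> \<Delta>" using complex unfolding simplicial_complex_def by blast
    ultimately obtain F where "F \<in> \<Delta>" "{undefined} \<subseteq> F" "\<forall>G\<in>\<Delta>. F \<subseteq> G \<longrightarrow> F = G"
      using finite_has_maximal2[of \<Delta> "{undefined}"] by blast
    then show ?thesis using that unfolding facets_def by blast
  qed
  then have D: "D > 0" using card[OF F(1)] by (auto simp: card_gt_0_iff)
  have "face_dim ` ?S = {int D - 1}" using F(1) card unfolding face_dim_def by force
  then have d: "d = int D - 1" using assms(2) unfolding complex_dim_def by simp
  have "has_minimal_resolution (sqfree_ideal ?S :: ('v, 'k) mpoly set) (linear_tree_betti D ?S)"
    by (rule has_minimal_resolution_linked_forest[OF card D linked])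
      (use tree_facets_have_joint[OF tree] in blast)+
  moreover obtain n where n: "i = Suc n" using assms(5) by (cases i) auto
  ultimately have betti: "betti UNIV I i = linear_tree_betti D ?S i"
    unfolding assms(4) facet_ideal_eq_sqfree_ideal by (simp add: betti_eq is_ideal_sqfree_ideal)
  show ?thesis
  proof (cases "i = 1")
    case True
    then show ?thesis using betti assms(3) by (simp add: linear_tree_betti_def)
  next
    case False
    have "(\<Sum>G | Suc (card G) = D. ridge_degree ?S G choose i)
        = (\<Sum>G | G \<in> \<Delta> \<and> face_dim G = d - 1. card {F \<in> ?S. G \<subseteq> F} choose i)"
    proof (rule sum.mono_neutral_cong_right)
      show "finite {G :: 'v set. Suc (card G) = D}" by (rule finite_subset[of _ UNIV]) auto
      show "{G \<in> \<Delta>. face_dim G = d - 1} \<subseteq> {G. Suc (card G) = D}"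
        unfolding face_dim_def d by auto
      show "\<forall>G\<in>{G. Suc (card G) = D} - {G \<in> \<Delta>. face_dim G = d - 1}. ridge_degree ?S G choose i = 0"
      proof
        fix G assume "G \<in> {G. Suc (card G) = D} - {G \<in> \<Delta>. face_dim G = d - 1}"
        then have "G \<notin> \<Delta>" unfolding face_dim_def d by auto
        then have empty: "{F \<in> ?S. G \<subseteq> F} = {}"
          using complex unfolding facets_def simplicial_complex_def by blast
        show "ridge_degree ?S G choose i = 0" unfolding ridge_degree_def empty n by simp
      qed
    qed (simp add: ridge_degree_def)
    then show ?thesis unfolding betti linear_tree_betti_def using False assms(5) by simp
  qed
qed

end
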